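(* For every $n\in\mathbb{N}$, the space $\mathcal{GH}^{\leq n}$ of isometry classes of metric spaces with at most $n$ points, endowed with the Gromov-Hausdorff distance, has asymptotic dimension $n(n-1)/2$, and so it can be coarsely embedded into a Hilbert space.
   Context: $\mathbb{N}$ includes $0$. Metric spaces are nonempty. A correspondence between sets $X,Y$ is a relation $\mathcal{R}\subseteq X\times Y$ such that every $x\in X$ is related to at least one $y\in Y$ and vice versa. For a metric space $(Z,d)$ and $X,Y\subseteq Z$, the Hausdorff distance is $d_H(X,Y)=\inf_{\mathcal{R}\subseteq X\times Y\text{ correspondence}}\sup_{(x,y)\in\mathcal{R}}d(x,y)$. The Gromov-Hausdorff distance $d_{GH}(X,Y)$ of two metric spaces is the infimum of $d_H(i_X(X),i_Y(Y))$ over all metric spaces $Z$ and isometric embeddings $i_X\colon X\to Z$, $i_Y\colon Y\to Z$. Equivalently, $d_{GH}(X,Y)=\frac12\inf_{\mathcal{R}}\sup_{(x_1,y_1),(x_2,y_2)\in\mathcal{R}}|d_X(x_1,x_2)-d_Y(y_1,y_2)|$ over correspondences $\mathcal{R}$. The distance between isometry classes is the distance between representatives; $d_{GH}$ is a metric on isometry classes of finite metric spaces. Asymptotic dimension: a family $\mathcal{U}$ of subsets of a metric space is uniformly bounded if there is $R\ge 0$ with $\operatorname{diam}U\le R$ for all $U\in\mathcal{U}$; it is $r$-disjoint ($r>0$) if $\inf\{d(u,v)\mid u\in U,v\in V\}>r$ for all distinct $U,V\in\mathcal{U}$. For $m\in\mathbb{N}$, $\operatorname{asdim}X\le m$ if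 for every $r>0$ there is a uniformly bounded cover $\mathcal{U}=\mathcal{U}_0\cup\cdots\cup\mathcal{U}_m$ of $X$ with each $\mathcal{U}_i$ $r$-disjoint. $\operatorname{asdim}X$ is the least such $m\in\mathbb{N}$, and $\infty$ if there is none. A map $\psi\colon(X,d_X)\to(Y,d_Y)$ between metric spaces is a coarse embedding if there are maps $\rho_-,\rho_+\colon\mathbb{R}_{\ge0}\to\mathbb{R}_{\ge0}$ with $\rho_-(t)\to\infty$ as $t\to\infty$ such that $\rho_-(d_X(x,y))\le d_Y(\psi(x),\psi(y))\le\rho_+(d_X(x,y))$ for all $x,y\in X$. *)

theory Defs
  imports "HOL-Analysis.Analysis"
begin

section \<open>Hausdorff and Gromov--Hausdorff distance\<close>

definition correspondence :: "'a set \<Rightarrow> 'b set \<Rightarrow> ('a \<times> 'b) set \<Rightarrow> bool" where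
  "correspondence A B R \<longleftrightarrow>
     R \<subseteq> A \<times> B \<and> (\<forall>x\<in>A. \<exists>y\<in>B. (x, y) \<in> R) \<and> (\<forall>y\<in>B. \<exists>x\<in>A. (x, y) \<in> R)"

text \<open>Distances between sets and between spaces take values in \<^typ>\<open>ennreal\<close>, so that the
  suprema and infima are the mathematical ones also for unbounded sets.\<close>

definition hausdorff_distance :: "'a metric \<Rightarrow> 'a set \<Rightarrow> 'a set \<Rightarrow> ennreal" where
  "hausdorff_distance Z A B =
     (INF R\<in>{R. correspondence A B R}. SUP (x, y)\<in>R. ennreal (mdist Z x y))"

definition isometric_embedding :: "'a metric \<Rightarrow> 'b metric \<Rightarrow> ('a \<Rightarrow> 'b) \<Rightarrow> bool" where
  "isometric_embedding X Z f \<longleftrightarrow>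
     f ` mspace X \<subseteq> mspace Z \<and>
     (\<forall>x\<in>mspace X. \<forall>y\<in>mspace X. mdist Z (f x) (f y) = mdist X x y)"

text \<open>The ambient spaces range over metrics on subsets of \<^typ>\<open>'a + 'b\<close>. This is no restriction:
  only the union of the two images matters, and it injects into \<^typ>\<open>'a + 'b\<close>; see
  \<open>gh_distance_le\<close> below.\<close>

definition gh_distance :: "'a metric \<Rightarrow> 'b metric \<Rightarrow> ennreal" where
  "gh_distance X Y =
     Inf {hausdorff_distance Z (i ` mspace X) (j ` mspace Y) | (Z :: ('a + 'b) metric) i j.
            isometric_embedding X Z i \<and> isometric_embedding Y Z j}"

lemma Metric_space_pullback:
  assumes "inj_on h S" "h ` S \<subseteq> mspace Z"
  shows "Metric_space S (\<lambda>p q. mdist Z (h p) (h q))"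
proof
  fix x y z
  show "0 \<le> mdist Z (h x) (h y)" by simp
  show "mdist Z (h x) (h y) = mdist Z (h y) (h x)" by (simp add: mdist_commute)
  show "mdist Z (h x) (h y) = 0 \<longleftrightarrow> x = y" if "x \<in> S" "y \<in> S"
    using that assms by (metis image_subset_iff inj_on_contraD mdist_zero)
  show "mdist Z (h x) (h z) \<le> mdist Z (h x) (h y) + mdist Z (h y) (h z)"
    if "x \<in> S" "y \<in> S" "z \<in> S"
    using that assms by (simp add: image_subset_iff mdist_triangle)
qed

lemma gh_distance_le:
  fixes X :: "'a metric" and Y :: "'b metric" and Z :: "'c metric"
  assumes i: "isometric_embedding X Z i" and j: "isometric_embedding Y Z j"
  shows "gh_distance X Y \<le> hausdorff_distance Z (i ` mspace X) (j ` mspace Y)"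
proof -
  let ?A = "i ` mspace X" and ?B = "j ` mspace Y"
  define g :: "'c \<Rightarrow> 'a + 'b" where
    "g z = (if z \<in> ?A then Inl (inv_into (mspace X) i z) else Inr (inv_into (mspace Y) j z))" for z
  define S where "S = g ` (?A \<union> ?B)"
  define h :: "'a + 'b \<Rightarrow> 'c" where "h = case_sum i j"
  have hg: "h (g z) = z" if "z \<in> ?A \<union> ?B" for z
  proof (cases "z \<in> ?A")
    case True
    then show ?thesis by (simp add: g_def h_def f_inv_into_f)
  next
    case False
    with that have "z \<in> ?B" by blast
    with False show ?thesis by (simp add: g_def h_def f_inv_into_f)
  qed
  have hS: "h ` S = ?A \<union> ?B"
    unfolding S_def image_image using hg by simp
  have sub: "?A \<union> ?B \<subseteq> mspace Z"
    using i j by (auto simp: isometric_embedding_def)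
  define Z' where "Z' = metric (S, \<lambda>p q. mdist Z (h p) (h q))"
  have injh: "inj_on h S"
    by (rule inj_onI) (unfold S_def, use hg in force)
  interpret S: Metric_space S "\<lambda>p q. mdist Z (h p) (h q)"
    using injh hS sub by (intro Metric_space_pullback) auto
  have sp: "mspace Z' = S" and di: "mdist Z' p q = mdist Z (h p) (h q)" for p q
    unfolding Z'_def by simp_all
  have "isometric_embedding X Z' (g \<circ> i)" "isometric_embedding Y Z' (g \<circ> j)"
    using i j by (auto simp: isometric_embedding_def sp di hg S_def)
  then have "gh_distance X Y \<le> hausdorff_distance Z' ((g \<circ> i) ` mspace X) ((g \<circ> j) ` mspace Y)"
    unfolding gh_distance_def by (intro Inf_lower) blast
  also have "\<dots> \<le> hausdorff_distance Z ?A ?B"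
    unfolding hausdorff_distance_def
  proof (rule INF_mono)
    fix R assume "R \<in> {R. correspondence ?A ?B R}"
    then have R: "correspondence ?A ?B R" by simp
    then have Rsub: "R \<subseteq> ?A \<times> ?B" by (auto simp: correspondence_def)
    let ?R = "map_prod g g ` R"
    have "correspondence ((g \<circ> i) ` mspace X) ((g \<circ> j) ` mspace Y) ?R"
      unfolding correspondence_def
    proof (intro conjI ballI)
      show "?R \<subseteq> (g \<circ> i) ` mspace X \<times> (g \<circ> j) ` mspace Y"
        using Rsub by (fastforce simp: image_comp[symmetric])
    next
      fix x assume "x \<in> (g \<circ> i) ` mspace X"
      then obtain a where a: "a \<in> ?A" "x = g a" by auto
      then obtain b where "b \<in> ?B" "(a, b) \<in> R"
        using R unfolding correspondence_def by blast
      then show "\<exists>y\<in>(g \<circ> j) ` mspace Y. (x, y) \<in> ?R"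
        unfolding image_comp[symmetric] a(2) by (intro bexI[of _ "g b"]) force+
    next
      fix y assume "y \<in> (g \<circ> j) ` mspace Y"
      then obtain b where b: "b \<in> ?B" "y = g b" by auto
      then obtain a where "a \<in> ?A" "(a, b) \<in> R"
        using R unfolding correspondence_def by blast
      then show "\<exists>x\<in>(g \<circ> i) ` mspace X. (x, y) \<in> ?R"
        unfolding image_comp[symmetric] b(2) by (intro bexI[of _ "g a"]) force+
    qed
    moreover have "(SUP (x, y)\<in>?R. ennreal (mdist Z' x y)) \<le> (SUP (x, y)\<in>R. ennreal (mdist Z x y))"
    proof (rule SUP_least)
      fix p assume "p \<in> ?R"
      then obtain a b where ab: "(a, b) \<in> R" "p = (g a, g b)" by auto
      then have "mdist Z' (g a) (g b) = mdist Z a b"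
        using Rsub by (auto simp: di hg)
      then show "(case p of (x, y) \<Rightarrow> ennreal (mdist Z' x y)) \<le> (SUP (x, y)\<in>R. ennreal (mdist Z x y))"
        using ab by (auto intro!: SUP_upper2[of "(a, b)"])
    qed
    ultimately show "\<exists>m\<in>{R. correspondence ((g \<circ> i) ` mspace X) ((g \<circ> j) ` mspace Y) R}.
        (SUP (x, y)\<in>m. ennreal (mdist Z' x y)) \<le> (SUP (x, y)\<in>R. ennreal (mdist Z x y))"
      by blast
  qed
  finally show ?thesis .
qed


section \<open>The space of isometry classes of metric spaces with at most \<open>n\<close> points\<close>

definition isometric :: "'a metric \<Rightarrow> 'b metric \<Rightarrow> bool" where
  "isometric X Y \<longleftrightarrow> (\<exists>f. isometric_embedding X Y f \<and> f ` mspace X = mspace Y)"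

text \<open>Finite metric spaces are taken on subsets of \<^typ>\<open>nat\<close>; every finite metric space is
  isometric to one of these. The library's type of metrics includes the empty space, which has to
  be excluded.\<close>

definition metrics_upto :: "nat \<Rightarrow> nat metric set" where
  "metrics_upto n = {X. mspace X \<noteq> {} \<and> finite (mspace X) \<and> card (mspace X) \<le> n}"

lemma ex_isometric_nat_metric:
  assumes "mspace X \<noteq> {}" "finite (mspace X)" "card (mspace X) \<le> n"
  shows "\<exists>Y \<in> metrics_upto n. isometric X Y"
proof -
  obtain h where h: "bij_betw h {0..<card (mspace X)} (mspace X)"
    using ex_bij_betw_nat_finite assms(2) by blast
  let ?S = "{0..<card (mspace X)}"
  interpret S: Metric_space ?S "\<lambda>p q. mdist X (h p) (h q)"
    using h by (intro Metric_space_pullback) (auto simp: bij_betw_def)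
  define Y where "Y = metric (?S, \<lambda>p q. mdist X (h p) (h q))"
  have sp: "mspace Y = ?S" and di: "mdist Y p q = mdist X (h p) (h q)" for p q
    unfolding Y_def by simp_all
  have "Y \<in> metrics_upto n"
    using assms by (simp add: metrics_upto_def sp card_gt_0_iff)
  moreover have "isometric X Y"
    unfolding isometric_def isometric_embedding_def sp di
    using bij_betw_inv_into[OF h] bij_betw_inv_into_right[OF h]
    by (intro exI[of _ "inv_into ?S h"]) (auto simp: bij_betw_def)
  ultimately show ?thesis by blast
qed

definition GH_upto :: "nat \<Rightarrow> nat metric set set" where
  "GH_upto n = metrics_upto n //
     {(X, Y). X \<in> metrics_upto n \<and> Y \<in> metrics_upto n \<and> isometric X Y}"

text \<open>The distance of two classes is that of representatives. It is finite for bounded nonempty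
  spaces, so the conversion to \<^typ>\<open>real\<close> loses nothing on \<^const>\<open>GH_upto\<close>.\<close>

definition GH_dist :: "nat metric set \<Rightarrow> nat metric set \<Rightarrow> real" where
  "GH_dist C D = enn2real (gh_distance (SOME X. X \<in> C) (SOME Y. Y \<in> D))"


section \<open>Asymptotic dimension\<close>

text \<open>As with the library's \<^locale>\<open>Metric_space\<close>, a metric space is given by a carrier and a
  distance function.\<close>

definition uniformly_bounded :: "('a \<Rightarrow> 'a \<Rightarrow> real) \<Rightarrow> 'a set set \<Rightarrow> bool" where
  "uniformly_bounded d \<U> \<longleftrightarrow> (\<exists>R\<ge>0. \<forall>U\<in>\<U>. \<forall>x\<in>U. \<forall>y\<in>U. d x y \<le> R)"

text \<open>The infimum is taken in \<^typ>\<open>ennreal\<close> because the sets may be empty.\<close>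

definition r_disjoint :: "('a \<Rightarrow> 'a \<Rightarrow> real) \<Rightarrow> real \<Rightarrow> 'a set set \<Rightarrow> bool" where
  "r_disjoint d r \<U> \<longleftrightarrow>
     (\<forall>U\<in>\<U>. \<forall>V\<in>\<U>. U \<noteq> V \<longrightarrow> (INF (u, v)\<in>U \<times> V. ennreal (d u v)) > ennreal r)"

definition asdim_le :: "'a set \<Rightarrow> ('a \<Rightarrow> 'a \<Rightarrow> real) \<Rightarrow> nat \<Rightarrow> bool" where
  "asdim_le M d m \<longleftrightarrow>
     (\<forall>r>0. \<exists>\<U> :: nat \<Rightarrow> 'a set set.
        (\<Union>i\<le>m. \<U> i) \<subseteq> Pow M \<and> \<Union>(\<Union>i\<le>m. \<U> i) = M \<and>
        uniformly_bounded d (\<Union>i\<le>m. \<U> i) \<and> (\<forall>i\<le>m. r_disjoint d r (\<U> i)))"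

definition asdim :: "'a set \<Rightarrow> ('a \<Rightarrow> 'a \<Rightarrow> real) \<Rightarrow> enat" where
  "asdim M d = (if \<exists>m. asdim_le M d m then enat (LEAST m. asdim_le M d m) else \<infinity>)"


section \<open>Coarse embeddings into Hilbert spaces\<close>

definition coarse_embedding ::
  "'a set \<Rightarrow> ('a \<Rightarrow> 'a \<Rightarrow> real) \<Rightarrow> 'b set \<Rightarrow> ('b \<Rightarrow> 'b \<Rightarrow> real) \<Rightarrow> ('a \<Rightarrow> 'b) \<Rightarrow> bool" where
  "coarse_embedding M d N e \<psi> \<longleftrightarrow>
     \<psi> ` M \<subseteq> N \<and>
     (\<exists>\<rho>1 \<rho>2 :: real \<Rightarrow> real.
        (\<forall>t\<ge>0. \<rho>1 t \<ge> 0 \<and> \<rho>2 t \<ge> 0) \<and> filterlim \<rho>1 at_top at_top \<and>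
        (\<forall>x\<in>M. \<forall>y\<in>M. \<rho>1 (d x y) \<le> e (\<psi> x) (\<psi> y) \<and> e (\<psi> x) (\<psi> y) \<le> \<rho>2 (d x y)))"

definition hilbert_dist ::
  "('h \<Rightarrow> 'h \<Rightarrow> 'h) \<Rightarrow> (real \<Rightarrow> 'h \<Rightarrow> 'h) \<Rightarrow> ('h \<Rightarrow> 'h \<Rightarrow> real) \<Rightarrow> 'h \<Rightarrow> 'h \<Rightarrow> real" where
  "hilbert_dist add smul ip x y = sqrt (ip (add x (smul (-1) y)) (add x (smul (-1) y)))"

text \<open>The existence of a Hilbert space cannot be expressed with the classes
  \<^class>\<open>real_inner\<close> and \<^class>\<open>complete_space\<close>, as types cannot be quantified existentially.
  Hence a version with explicit carrier and operations.\<close>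

locale real_hilbert_space =
  fixes V :: "'h set"
    and zero :: 'h
    and add :: "'h \<Rightarrow> 'h \<Rightarrow> 'h"
    and smul :: "real \<Rightarrow> 'h \<Rightarrow> 'h"
    and ip :: "'h \<Rightarrow> 'h \<Rightarrow> real"
  assumes zero_closed: "zero \<in> V"
    and add_closed: "\<lbrakk>x \<in> V; y \<in> V\<rbrakk> \<Longrightarrow> add x y \<in> V"
    and scale_closed: "x \<in> V \<Longrightarrow> smul a x \<in> V"
    and add_assoc: "\<lbrakk>x \<in> V; y \<in> V; z \<in> V\<rbrakk> \<Longrightarrow> add (add x y) z = add x (add y z)"
    and add_commute: "\<lbrakk>x \<in> V; y \<in> V\<rbrakk> \<Longrightarrow> add x y = add y x"
    and add_zero: "x \<in> V \<Longrightarrow> add x zero = x"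
    and add_minus: "x \<in> V \<Longrightarrow> add x (smul (-1) x) = zero"
    and scale_add_right: "\<lbrakk>x \<in> V; y \<in> V\<rbrakk> \<Longrightarrow> smul a (add x y) = add (smul a x) (smul a y)"
    and scale_add_left: "x \<in> V \<Longrightarrow> smul (a + b) x = add (smul a x) (smul b x)"
    and scale_scale: "x \<in> V \<Longrightarrow> smul a (smul b x) = smul (a * b) x"
    and scale_one: "x \<in> V \<Longrightarrow> smul 1 x = x"
    and ip_commute: "\<lbrakk>x \<in> V; y \<in> V\<rbrakk> \<Longrightarrow> ip x y = ip y x"
    and ip_add: "\<lbrakk>x \<in> V; y \<in> V; z \<in> V\<rbrakk> \<Longrightarrow> ip (add x y) z = ip x z + ip y z"
    and ip_scale: "\<lbrakk>x \<in> V; y \<in> V\<rbrakk> \<Longrightarrow> ip (smul a x) y = a * ip x y"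
    and ip_nonneg: "x \<in> V \<Longrightarrow> 0 \<le> ip x x"
    and ip_eq_zero: "x \<in> V \<Longrightarrow> ip x x = 0 \<Longrightarrow> x = zero"
    and complete: "\<And>s :: nat \<Rightarrow> 'h.
      \<lbrakk>range s \<subseteq> V;
       \<forall>\<epsilon>>0. \<exists>k. \<forall>m\<ge>k. \<forall>n\<ge>k. hilbert_dist add smul ip (s m) (s n) < \<epsilon>\<rbrakk>
      \<Longrightarrow> \<exists>l\<in>V. (\<lambda>n. hilbert_dist add smul ip (s n) l) \<longlonglongrightarrow> 0"

lemma hilbert_dist_class:
  "hilbert_dist (+) (*\<^sub>R) (\<bullet>) x y = dist x (y :: 'h :: real_inner)"
  by (simp add: hilbert_dist_def dist_norm norm_eq_sqrt_inner)

lemma real_hilbert_space_class: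
  "real_hilbert_space (UNIV :: 'h :: {real_inner, complete_space} set) 0 (+) (*\<^sub>R) (\<bullet>)"
proof
  fix s :: "nat \<Rightarrow> 'h"
  assume "\<forall>\<epsilon>>0. \<exists>k. \<forall>m\<ge>k. \<forall>n\<ge>k. hilbert_dist (+) (*\<^sub>R) (\<bullet>) (s m) (s n) < \<epsilon>"
  then have "Cauchy s"
    by (simp add: Cauchy_def hilbert_dist_class)
  then obtain l where "s \<longlonglongrightarrow> l"
    using Cauchy_convergent_iff convergent_def by blast
  then show "\<exists>l\<in>UNIV. (\<lambda>n. hilbert_dist (+) (*\<^sub>R) (\<bullet>) (s n) l) \<longlonglongrightarrow> 0"
    using tendsto_dist_iff[of s l sequentially] by (auto simp: hilbert_dist_class)
qed (auto simp: inner_add_left inner_add_right inner_commute scaleR_add_left scaleR_add_right)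

text \<open>The carrier may be any set of functions \<^typ>\<open>nat \<times> 'a \<Rightarrow> real\<close>, with arbitrary operations on
  it. This is no restriction: the closed linear span of the image of a map from \<^typ>\<open>'a\<close> into a
  Hilbert space has an orthonormal basis indexed by a subset of \<^typ>\<open>nat \<times> 'a\<close>, so it is isomorphic
  to a space of such functions.\<close>

definition coarsely_embeds_into_hilbert_space :: "'a set \<Rightarrow> ('a \<Rightarrow> 'a \<Rightarrow> real) \<Rightarrow> bool" where
  "coarsely_embeds_into_hilbert_space M d \<longleftrightarrow>
     (\<exists>(V :: (nat \<times> 'a \<Rightarrow> real) set) zero add smul ip \<psi>.
        real_hilbert_space V zero add smul ip \<and>
        coarse_embedding M d V (hilbert_dist add smul ip) \<psi>)"

end

theory Submission
  imports Defs
begin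

text \<open>Upper bound. Colour a metric with \<open>n\<close> separated points by the dimension of the skeleton of a
  cubical decomposition of \<open>\<real>\<^sup>N\<close>, \<open>N = n (n - 1) / 2\<close>, to which its distance matrix is close. The
  decomposition is invariant under permutations of the coordinates, so the colour does not depend on
  the enumeration of the points. Chains of small steps in one colour lift to matrices, where they
  stay near one cube and thus have bounded diameter. Metrics with two close points are near metrics with
  fewer points, which allows an induction on \<open>n\<close>.

  Lower bound. A large cube of \<open>\<real>\<^sup>N\<close> embeds into the space of metrics with \<open>n\<close> points when the
  distances of different pairs of points vary in intervals far from each other; such a cube has no
  cover by \<open>N\<close> families of small, pairwise distant sets, by Kuhn's lemma.

  Hilbert space. Tent functions of the components at the scales \<open>2 ^ k\<close> give a map into the
  square-summable functions. It is Lipschitz since every point lies in the supports of boundedly many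
  tents at each scale, and distant points are separated by the tents at many scales.\<close>

section \<open>Monochromatic chains and asymptotic dimension\<close>

text \<open>Isometry classes are distance matrices modulo permutations, and the enumeration of the
  points is lost where points merge. Keeping all distances above \<open>\<rho>\<close> with
  \<open>2 * r < \<rho>\<close> cures this: each step of length \<open>r\<close> is then realised by
  a bijection, and composing these carries one enumeration along a whole chain. Chains have
  unbounded length, so displacements cannot be summed; what survives is the cell of each entry,
  because minimality of the colour keeps every entry out of a shell of width \<open>\<rho>\<close>
  that no step can cross. Metrics with merging points form a second piece. It has no larger
  dimension, but its colouring has to be chosen at a scale beyond the diameter bound
  \<open>L\<close> of the first piece, which an induction hypothesis for all scales permits.\<close>

definition chain_step :: "'a set \<Rightarrow> ('a \<Rightarrow> 'a \<Rightarrow> real) \<Rightarrow> ('a \<Rightarrow> nat) \<Rightarrow> real \<Rightarrow> 'a rel" where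
  "chain_step M d c r = {(x, y). x \<in> M \<and> y \<in> M \<and> c x = c y \<and> d x y \<le> r}"

definition chain_colouring ::
  "'a set \<Rightarrow> ('a \<Rightarrow> 'a \<Rightarrow> real) \<Rightarrow> nat \<Rightarrow> real \<Rightarrow> ('a \<Rightarrow> nat) \<Rightarrow> real \<Rightarrow> bool" where
  "chain_colouring M d m r c B \<longleftrightarrow>
     (\<forall>x\<in>M. c x \<le> m) \<and> (\<forall>x\<in>M. \<forall>y. (x, y) \<in> (chain_step M d c r)\<^sup>* \<longrightarrow> d x y \<le> B)"

text \<open>A reformulation of \<^const>\<open>asdim_le\<close>: the chain components of colour \<open>i\<close> form the family
  \<open>\<U> i\<close>.\<close>

definition coarse_dim_le :: "'a set \<Rightarrow> ('a \<Rightarrow> 'a \<Rightarrow> real) \<Rightarrow> nat \<Rightarrow> bool" where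
  "coarse_dim_le M d m \<longleftrightarrow> (\<forall>r>0. \<exists>c B. chain_colouring M d m r c B)"

lemma chain_colouring_mono: "\<lbrakk>chain_colouring M d m r c B; m \<le> m'\<rbrakk> \<Longrightarrow> chain_colouring M d m' r c B"
  unfolding chain_colouring_def using order_trans by blast

lemma coarse_dim_le_mono:
  assumes "coarse_dim_le M d m" "m \<le> m'"
  shows "coarse_dim_le M d m'"
  unfolding coarse_dim_le_def
proof (intro allI impI)
  fix r :: real assume "r > 0"
  then obtain c B where "chain_colouring M d m r c B"
    using assms(1) by (auto simp: coarse_dim_le_def)
  then show "\<exists>c B. chain_colouring M d m' r c B"
    using chain_colouring_mono[OF _ assms(2)] by blast
qed

lemma coarse_dim_le_empty: "coarse_dim_le {} d m"
  by (auto simp: coarse_dim_le_def chain_colouring_def)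

lemma chain_step_mem:
  "(x, y) \<in> (chain_step M d c r)\<^sup>* \<Longrightarrow> x \<in> M \<Longrightarrow> y \<in> M \<and> c y = c x"
  by (induction rule: rtrancl_induct) (auto simp: chain_step_def)

text \<open>\<open>\<pi>\<close> carries a monochromatic chain of scale \<open>r\<close> to one of
  scale \<open>r + K\<close>; comparing the end points costs another \<open>K\<close>.\<close>

lemma chain_colouring_pullback:
  assumes col: "chain_colouring M' d' m (r + K) c B" and \<pi>: "\<pi> ` M \<subseteq> M'"
    and up: "\<And>x y. x \<in> M \<Longrightarrow> y \<in> M \<Longrightarrow> d' (\<pi> x) (\<pi> y) \<le> d x y + K"
    and lo: "\<And>x y. x \<in> M \<Longrightarrow> y \<in> M \<Longrightarrow> d x y \<le> d' (\<pi> x) (\<pi> y) + K"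
  shows "chain_colouring M d m r (c \<circ> \<pi>) (B + K)"
  unfolding chain_colouring_def
proof (intro conjI ballI allI impI)
  show "(c \<circ> \<pi>) x \<le> m" if "x \<in> M" for x
    using col \<pi> that by (auto simp: chain_colouring_def)
next
  fix x y assume x: "x \<in> M" and xy: "(x, y) \<in> (chain_step M d (c \<circ> \<pi>) r)\<^sup>*"
  have "(\<pi> x, \<pi> y) \<in> (chain_step M' d' c (r + K))\<^sup>*"
    using xy
  proof (induction rule: rtrancl_induct)
    case (step y z)
    then have "(\<pi> y, \<pi> z) \<in> chain_step M' d' c (r + K)"
      using \<pi> up[of y z] by (auto simp: chain_step_def)
    with step show ?case by simp
  qed simp
  then have "d' (\<pi> x) (\<pi> y) \<le> B"
    using col x \<pi> by (auto simp: chain_colouring_def)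
  then show "d x y \<le> B + K"
    using lo[OF x, of y] chain_step_mem[OF xy x] by simp
qed

lemma coarse_dim_le_pullback:
  assumes "coarse_dim_le M' d' m" "\<pi> ` M \<subseteq> M'" "K \<ge> 0"
    "\<And>x y. x \<in> M \<Longrightarrow> y \<in> M \<Longrightarrow> d' (\<pi> x) (\<pi> y) \<le> d x y + K"
    "\<And>x y. x \<in> M \<Longrightarrow> y \<in> M \<Longrightarrow> d x y \<le> d' (\<pi> x) (\<pi> y) + K"
  shows "coarse_dim_le M d m"
  unfolding coarse_dim_le_def
proof (intro allI impI)
  fix r :: real assume "r > 0"
  then obtain c B where "chain_colouring M' d' m (r + K) c B"
    using assms(1,3) unfolding coarse_dim_le_def by (metis add_pos_nonneg)
  then have "chain_colouring M d m r (c \<circ> \<pi>) (B + K)"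
    by (rule chain_colouring_pullback) (use assms in auto)
  then show "\<exists>c B. chain_colouring M d m r c B" by blast
qed

text \<open>Distinct isometric metrics have distance 0, so this setting serves both for metrics on
  sets of numbers and for their classes.\<close>

locale pseudometric =
  fixes M :: "'a set" and d :: "'a \<Rightarrow> 'a \<Rightarrow> real"
  assumes nonneg: "\<lbrakk>x \<in> M; y \<in> M\<rbrakk> \<Longrightarrow> 0 \<le> d x y"
    and self: "x \<in> M \<Longrightarrow> d x x = 0"
    and commute: "\<lbrakk>x \<in> M; y \<in> M\<rbrakk> \<Longrightarrow> d x y = d y x"
    and triangle: "\<lbrakk>x \<in> M; y \<in> M; z \<in> M\<rbrakk> \<Longrightarrow> d x z \<le> d x y + d y z"
begin

text \<open>A chain of \<open>A \<union> C\<close> meets \<open>A\<close> in a chain of coarser scale, since its excursions into \<open>C\<close> have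
  diameter at most \<open>B\<^sub>C\<close>.\<close>

lemma chain_colouring_Un:
  assumes sub: "A \<subseteq> M" "C \<subseteq> M" and r: "r > 0" and B0: "B\<^sub>C \<ge> 0"
    and colC: "chain_colouring C d m r c\<^sub>C B\<^sub>C"
    and colA: "chain_colouring A d m (B\<^sub>C + 2 * r) c\<^sub>A B\<^sub>A"
  shows "chain_colouring (A \<union> C) d m r (\<lambda>x. if x \<in> A then c\<^sub>A x else c\<^sub>C x)
           (max B\<^sub>A 0 + 2 * (B\<^sub>C + r))"
proof -
  define c where "c x = (if x \<in> A then c\<^sub>A x else c\<^sub>C x)" for x
  let ?E = "chain_step (A \<union> C) d c r" and ?C = "chain_step C d c\<^sub>C r"
    and ?A = "chain_step A d c\<^sub>A (B\<^sub>C + 2 * r)"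
  have bC: "d x y \<le> B\<^sub>C" if "(x, y) \<in> ?C\<^sup>*" "x \<in> C" for x y
    using colC that by (auto simp: chain_colouring_def)
  have bA: "d x y \<le> B\<^sub>A" if "(x, y) \<in> ?A\<^sup>*" "x \<in> A" for x y
    using colA that by (auto simp: chain_colouring_def)
  have main: "d x y \<le> max B\<^sub>A 0 + 2 * (B\<^sub>C + r)" if x: "x \<in> A \<union> C" and xy: "(x, y) \<in> ?E\<^sup>*" for x y
  proof -
    \<comment> \<open>States of a walk that has reached \<open>y\<close>. In \<open>inC\<close> it
      has not met \<open>A\<close> yet. Otherwise \<open>a\<close> is its first and
      \<open>a'\<close> its latest point in \<open>A\<close>: \<open>Q\<close> joins them by a
      coarse chain of \<open>A\<close>, and \<open>T\<close> describes the current excursion, a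
      chain of \<open>C\<close> entered at a point \<open>z\<close> within \<open>r\<close> of
      \<open>a'\<close>.\<close>
    define inC where "inC y \<longleftrightarrow> x \<in> C \<and> y \<in> C - A \<and> (x, y) \<in> ?C\<^sup>*" for y
    define Q where "Q a a' \<longleftrightarrow> a \<in> A \<and> (a, a') \<in> ?A\<^sup>* \<and> d x a \<le> B\<^sub>C + r" for a a'
    define T where "T a' y \<longleftrightarrow> c a' = c y \<and>
        (y = a' \<or> (\<exists>z. z \<in> C \<and> y \<in> C - A \<and> d a' z \<le> r \<and> (z, y) \<in> ?C\<^sup>*))" for a' y
    have QA: "a \<in> A" "a' \<in> A" if "Q a a'" for a a'
      using that chain_step_mem[of a a'] by (auto simp: Q_def)
    have T_dist: "d a' y \<le> B\<^sub>C + r" if "T a' y" "a' \<in> A" for a' y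
      using that(1) unfolding T_def
    proof (elim disjE conjE exE)
      assume "y = a'"
      then show ?thesis using self[of a'] that sub B0 r by auto
    next
      fix z assume z: "z \<in> C" "y \<in> C - A" "d a' z \<le> r" "(z, y) \<in> ?C\<^sup>*"
      have "d a' y \<le> d a' z + d z y"
        using z that sub by (intro triangle) auto
      then show ?thesis using bC[OF z(4,1)] z by linarith
    qed
    have "inC y \<or> (\<exists>a a'. Q a a' \<and> T a' y)"
      using xy
    proof (induction rule: rtrancl_induct)
      case base
      show ?case
      proof (cases "x \<in> A")
        case True
        then have "Q x x" "T x x" using sub r B0 self[of x] by (auto simp: Q_def T_def)
        then show ?thesis by blast
      next
        case False
        then show ?thesis using x by (auto simp: inC_def)
      qed
    next
      case (step y w)
      then have yw: "y \<in> A \<union> C" "w \<in> A \<union> C" "c y = c w" "d y w \<le> r"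
        by (auto simp: chain_step_def)
      have Cext: "(z, w) \<in> ?C\<^sup>*" if "(z, y) \<in> ?C\<^sup>*" "y \<in> C - A" "w \<in> C - A" for z
        using that yw by (intro rtrancl_into_rtrancl[OF that(1)]) (auto simp: chain_step_def c_def)
      show ?case using step.IH
      proof (elim disjE exE)
        assume "inC y"
        then have *: "x \<in> C" "y \<in> C - A" "(x, y) \<in> ?C\<^sup>*" by (auto simp: inC_def)
        show ?thesis
        proof (cases "w \<in> A")
          case True
          have "d x w \<le> d x y + d y w"
            using True * sub by (intro triangle) auto
          then have "Q w w" "T w w" using True bC[OF *(3,1)] yw by (auto simp: Q_def T_def)
          then show ?thesis by blast
        next
          case False
          then have "inC w" using * yw Cext by (auto simp: inC_def)
          then show ?thesis by blast
        qed
      next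
        fix a a' assume QT: "Q a a' \<and> T a' y"
        then have a': "a \<in> A" "a' \<in> A" using QA by auto
        have cy: "c a' = c y" using QT by (simp add: T_def)
        show ?thesis
        proof (cases "w \<in> A")
          case True
          \<comment> \<open>The excursion ends: \<open>B\<^sub>C + r\<close> from
            \<open>T_dist\<close> plus the step back into \<open>A\<close> gives the scale
            \<open>B\<^sub>C + 2 * r\<close> required of the colouring of \<open>A\<close>.\<close>
          have "d a' w \<le> d a' y + d y w"
            using True a' sub yw by (intro triangle) auto
          then have "(a', w) \<in> ?A"
            using T_dist[of a' y] QT a' True cy yw by (auto simp: chain_step_def c_def)
          then have "Q a w" "T w w" using QT by (auto simp: Q_def T_def)
          then show ?thesis by blast
        next
          case False
          then have w: "w \<in> C - A" using yw by auto
          have "y = a' \<or> (\<exists>z. z \<in> C \<and> y \<in> C - A \<and> d a' z \<le> r \<and> (z, y) \<in> ?C\<^sup>*)"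
            using QT by (simp add: T_def)
          then have "T a' w"
          proof (elim disjE exE conjE)
            assume "y = a'"
            then show ?thesis using w yw cy unfolding T_def by blast
          next
            fix z assume "z \<in> C" "y \<in> C - A" "d a' z \<le> r" "(z, y) \<in> ?C\<^sup>*"
            then show ?thesis using w yw cy Cext[of z] unfolding T_def by metis
          qed
          then show ?thesis using QT by blast
        qed
      qed
    qed
    then show ?thesis
    proof (elim disjE exE)
      assume "inC y"
      then show ?thesis using bC[of x y] r B0 by (auto simp: inC_def)
    next
      fix a a' assume QT: "Q a a' \<and> T a' y"
      then have a': "a \<in> A" "a' \<in> A" using QA by auto
      have y: "y \<in> A \<union> C" using QT a' by (auto simp: T_def)
      have "d x y \<le> d x a + d a y" "d a y \<le> d a a' + d a' y"
        using x y a' sub by (auto intro!: triangle)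
      moreover have "d x a \<le> B\<^sub>C + r" "d a a' \<le> B\<^sub>A"
        using QT bA a' by (auto simp: Q_def)
      ultimately show ?thesis using T_dist[of a' y, OF conjunct2[OF QT] a'(2)] max.cobounded1[of B\<^sub>A 0] by argo
    qed
  qed
  show ?thesis
    unfolding chain_colouring_def c_def[symmetric]
    using main colC colA by (auto simp: chain_colouring_def c_def)
qed

text \<open>The function \<open>l\<close> names the chain components.\<close>

lemma coarse_dim_le_labelling:
  assumes "coarse_dim_le M d m" "r > 0"
  obtains c l B where "\<And>x. x \<in> M \<Longrightarrow> c x \<le> m" "\<And>x. x \<in> M \<Longrightarrow> l x \<in> M" "B \<ge> 0"
    "\<And>x y. \<lbrakk>x \<in> M; y \<in> M; c x = c y; d x y \<le> r\<rbrakk> \<Longrightarrow> l x = l y"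
    "\<And>x y. \<lbrakk>x \<in> M; y \<in> M; l x = l y\<rbrakk> \<Longrightarrow> c x = c y \<and> d x y \<le> B"
proof -
  obtain c B where col: "chain_colouring M d m r c B"
    using assms by (auto simp: coarse_dim_le_def)
  let ?E = "(chain_step M d c r)\<^sup>*"
  define l where "l x = (SOME y. (x, y) \<in> ?E)" for x
  have l: "(x, l x) \<in> ?E" for x
    unfolding l_def by (rule someI[of _ x]) simp
  have sym: "(y, x) \<in> ?E" if "(x, y) \<in> ?E" for x y
  proof -
    have "sym (chain_step M d c r)"
      by (rule symI) (simp add: chain_step_def commute)
    then show ?thesis using that by (blast intro: symD sym_rtrancl)
  qed
  have leq: "l x = l y" if "(x, y) \<in> ?E" for x y
  proof -
    have "(x, z) \<in> ?E \<longleftrightarrow> (y, z) \<in> ?E" for z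
      using rtrancl_trans[OF that, of z] rtrancl_trans[OF sym[OF that], of z] by blast
    then show ?thesis by (simp add: l_def)
  qed
  show thesis
  \<comment> \<open>\<open>B\<close> can be negative only if \<open>M\<close> is empty, as every
    point is joined to itself.\<close>
  proof (rule that[of c l "max B 0"])
    show "c x \<le> m" if "x \<in> M" for x
      using col that by (simp add: chain_colouring_def)
    show "l x \<in> M" if "x \<in> M" for x
      using chain_step_mem[OF l that] by simp
    show "l x = l y" if "x \<in> M" "y \<in> M" "c x = c y" "d x y \<le> r" for x y
      using that by (intro leq r_into_rtrancl) (simp add: chain_step_def)
    show "c x = c y \<and> d x y \<le> max B 0" if "x \<in> M" "y \<in> M" "l x = l y" for x y
    proof -
      have xy: "(x, y) \<in> ?E"
        using rtrancl_trans[OF l[of x], of y] sym[OF l[of y]] that by simp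
      then have "c y = c x" "d x y \<le> B"
        using chain_step_mem[OF xy] that col by (auto simp: chain_colouring_def)
      then show ?thesis by simp
    qed
  qed simp
qed

lemma coarse_dim_le_imp_asdim_le:
  assumes "coarse_dim_le M d m"
  shows "asdim_le M d m"
  unfolding asdim_le_def
proof (intro allI impI)
  fix r :: real assume r: "r > 0"
  \<comment> \<open>The infimum has to exceed \<open>r\<close> strictly. Pointwise separation beyond
    \<open>r + 1\<close> keeps it at least \<open>r + 1\<close>.\<close>
  then have r1: "r + 1 > 0" by simp
  show "\<exists>\<U> :: nat \<Rightarrow> 'a set set.
        (\<Union>i\<le>m. \<U> i) \<subseteq> Pow M \<and> \<Union>(\<Union>i\<le>m. \<U> i) = M \<and>
        uniformly_bounded d (\<Union>i\<le>m. \<U> i) \<and> (\<forall>i\<le>m. r_disjoint d r (\<U> i))"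
  proof (rule coarse_dim_le_labelling[OF assms r1])
    fix c l B assume c: "\<And>x. x \<in> M \<Longrightarrow> c x \<le> m" and B: "(0::real) \<le> B"
      and near: "\<And>x y. \<lbrakk>x \<in> M; y \<in> M; c x = c y; d x y \<le> r + 1\<rbrakk> \<Longrightarrow> l x = l y"
      and bdd: "\<And>x y. \<lbrakk>x \<in> M; y \<in> M; l x = l y\<rbrakk> \<Longrightarrow> c x = c y \<and> d x y \<le> B"
    define \<U> where "\<U> i = {{y \<in> M. l y = l x} | x. x \<in> M \<and> c x = i}" for i
    show ?thesis
    proof (intro exI[of _ \<U>] conjI allI impI)
      show "(\<Union>i\<le>m. \<U> i) \<subseteq> Pow M" by (auto simp: \<U>_def)
      show "\<Union>(\<Union>i\<le>m. \<U> i) = M"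
      proof (intro equalityI subsetI)
        fix x assume "x \<in> M"
        then have "x \<in> {y \<in> M. l y = l x}" "{y \<in> M. l y = l x} \<in> \<U> (c x)" "c x \<le> m"
          using c by (auto simp: \<U>_def)
        then show "x \<in> \<Union>(\<Union>i\<le>m. \<U> i)" by blast
      qed (auto simp: \<U>_def)
      have "d x y \<le> B" if "U \<in> \<U> i" "x \<in> U" "y \<in> U" for U i x y
      proof -
        have "x \<in> M" "y \<in> M" "l x = l y" using that by (auto simp: \<U>_def)
        then show ?thesis by (rule bdd[THEN conjunct2])
      qed
      then show "uniformly_bounded d (\<Union>i\<le>m. \<U> i)"
        unfolding uniformly_bounded_def using B by blast
      show "r_disjoint d r (\<U> i)" for i
        unfolding r_disjoint_def
      proof (intro ballI impI)
        fix U V assume "U \<in> \<U> i" "V \<in> \<U> i" and UV: "U \<noteq> V"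
        then obtain x y where x: "x \<in> M" "c x = i" "U = {z \<in> M. l z = l x}"
          and y: "y \<in> M" "c y = i" "V = {z \<in> M. l z = l y}" by (auto simp: \<U>_def)
        have "d u v > r + 1" if "u \<in> U" "v \<in> V" for u v
        proof (rule ccontr)
          assume "\<not> r + 1 < d u v"
          moreover have uv: "u \<in> M" "l u = l x" "v \<in> M" "l v = l y" using that x y by auto
          moreover have "c u = i" "c v = i"
            using bdd[THEN conjunct1, of u x] bdd[THEN conjunct1, of v y] x y uv by simp_all
          ultimately have "l u = l v" by (intro near) auto
          then show False using uv x y UV by simp
        qed
        then have "ennreal (r + 1) \<le> (INF (u, v)\<in>U \<times> V. ennreal (d u v))"
          by (intro INF_greatest) (force intro!: ennreal_leI intro: less_imp_le)
        then show "ennreal r < (INF (u, v)\<in>U \<times> V. ennreal (d u v))"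
          using r by (simp add: less_le_trans[OF ennreal_lessI[of "r + 1" r]])
      qed
    qed
  qed
qed

end

section \<open>The Hilbert space of square-summable functions\<close>

definition ell2 :: "('i \<Rightarrow> real) set" where
  "ell2 = {f. (\<lambda>i. (f i)\<^sup>2) summable_on UNIV}"

definition ell2_add :: "('i \<Rightarrow> real) \<Rightarrow> ('i \<Rightarrow> real) \<Rightarrow> 'i \<Rightarrow> real" where
  "ell2_add f g = (\<lambda>i. f i + g i)"

definition ell2_scale :: "real \<Rightarrow> ('i \<Rightarrow> real) \<Rightarrow> 'i \<Rightarrow> real" where
  "ell2_scale a f = (\<lambda>i. a * f i)"

definition ell2_inner :: "('i \<Rightarrow> real) \<Rightarrow> ('i \<Rightarrow> real) \<Rightarrow> real" where
  "ell2_inner f g = (\<Sum>\<^sub>\<infinity>i. f i * g i)"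

abbreviation ell2_dist :: "('i \<Rightarrow> real) \<Rightarrow> ('i \<Rightarrow> real) \<Rightarrow> real" where
  "ell2_dist \<equiv> hilbert_dist ell2_add ell2_scale ell2_inner"

text \<open>Reduces membership and norm bounds to finite sets of coordinates.\<close>

lemma ell2_bounded_sums:
  assumes "\<And>F. finite F \<Longrightarrow> (\<Sum>i\<in>F. (f i)\<^sup>2) \<le> C"
  shows "f \<in> ell2" "ell2_inner f f \<le> C"
proof -
  have "(\<lambda>i. (f i)\<^sup>2) summable_on UNIV"
    by (rule nonneg_bdd_above_summable_on) (use assms in \<open>auto intro!: bdd_aboveI2\<close>)
  then show "f \<in> ell2" "ell2_inner f f \<le> C"
    using infsum_le_finite_sums[of "\<lambda>i. (f i)\<^sup>2" UNIV C] assms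
    by (auto simp: ell2_def ell2_inner_def power2_eq_square)
qed

lemma ell2_sum_le_inner:
  assumes "f \<in> ell2" "finite F"
  shows "(\<Sum>i\<in>F. (f i)\<^sup>2) \<le> ell2_inner f f"
  using finite_sum_le_infsum[of "\<lambda>i. (f i)\<^sup>2" UNIV F] assms
  by (auto simp: ell2_def ell2_inner_def power2_eq_square)

lemma ell2_mult_summable:
  assumes "f \<in> ell2" "g \<in> ell2"
  shows "(\<lambda>i. f i * g i) summable_on UNIV"
proof -
  have "(\<lambda>i. (f i)\<^sup>2 + (g i)\<^sup>2) summable_on UNIV"
    using assms by (intro summable_on_add) (auto simp: ell2_def)
  then have "(\<lambda>i. \<bar>f i * g i\<bar>) summable_on UNIV"
  proof (rule summable_on_comparison_test)
    fix i
    have "0 \<le> (\<bar>f i\<bar> - \<bar>g i\<bar>)\<^sup>2" "0 \<le> (f i)\<^sup>2 + (g i)\<^sup>2" by auto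
    then show "\<bar>f i * g i\<bar> \<le> (f i)\<^sup>2 + (g i)\<^sup>2"
      unfolding power2_diff abs_mult power2_abs by linarith
  qed simp
  then show ?thesis
    by (subst summable_on_iff_abs_summable_on_real) (simp only: real_norm_def)
qed

lemma ell2_add_closed:
  assumes "f \<in> ell2" "g \<in> ell2"
  shows "ell2_add f g \<in> ell2"
proof -
  have "(\<lambda>i. (f i)\<^sup>2 + (g i)\<^sup>2 + 2 * (f i * g i)) summable_on UNIV"
    using assms ell2_mult_summable[OF assms]
    by (intro summable_on_add summable_on_cmult_right) (auto simp: ell2_def)
  then show ?thesis by (simp add: ell2_def ell2_add_def power2_sum mult.assoc)
qed

lemma ell2_scale_closed:
  assumes "f \<in> ell2"
  shows "ell2_scale a f \<in> ell2"
  using assms summable_on_cmult_right[of "\<lambda>i. (f i)\<^sup>2" UNIV "a\<^sup>2"]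
  by (simp add: ell2_def ell2_scale_def power_mult_distrib)

lemma ell2_dist_conv:
  "ell2_dist f g = sqrt (ell2_inner (\<lambda>i. f i - g i) (\<lambda>i. f i - g i))"
  by (simp add: hilbert_dist_def ell2_add_def ell2_scale_def)

lemma ell2_dist_nonneg: "0 \<le> ell2_dist f g"
  by (auto simp: ell2_dist_conv ell2_inner_def intro!: infsum_nonneg)

lemma ell2_diff_closed:
  assumes "f \<in> ell2" "g \<in> ell2"
  shows "(\<lambda>i. f i - g i) \<in> ell2"
  using ell2_add_closed[OF assms(1) ell2_scale_closed[OF assms(2), of "-1"]]
  by (simp add: ell2_add_def ell2_scale_def)

lemma ell2_sum_le_dist:
  assumes "f \<in> ell2" "g \<in> ell2" "finite F"
  shows "(\<Sum>i\<in>F. (f i - g i)\<^sup>2) \<le> (ell2_dist f g)\<^sup>2"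
proof -
  have "0 \<le> ell2_inner (\<lambda>i. f i - g i) (\<lambda>i. f i - g i)"
    by (auto simp: ell2_inner_def intro!: infsum_nonneg)
  then show ?thesis
    using ell2_sum_le_inner[OF ell2_diff_closed[OF assms(1,2)] assms(3)]
    by (simp add: ell2_dist_conv)
qed

text \<open>The limit exists in each coordinate. Finite partial sums pass the Cauchy bound to it,
  which yields both its membership and the convergence in norm.\<close>

lemma ell2_complete:
  fixes s :: "nat \<Rightarrow> 'i \<Rightarrow> real"
  assumes s: "range s \<subseteq> ell2"
    and cauchy: "\<forall>\<epsilon>>0. \<exists>k. \<forall>m\<ge>k. \<forall>n\<ge>k. ell2_dist (s m) (s n) < \<epsilon>"
  shows "\<exists>l\<in>ell2. (\<lambda>n. ell2_dist (s n) l) \<longlonglongrightarrow> 0"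
proof -
  have sn: "s n \<in> ell2" for n using s by auto
  have coord: "\<bar>s m i - s n i\<bar> \<le> ell2_dist (s m) (s n)" for m n i
    using ell2_sum_le_dist[OF sn[of m] sn[of n], of "{i}"] ell2_dist_nonneg[of "s m" "s n"]
    by (simp add: power2_le_iff_abs_le)
  have "Cauchy (\<lambda>n. s n i)" for i
    unfolding Cauchy_def dist_real_def using cauchy coord by (meson le_less_trans)
  then have "convergent (\<lambda>n. s n i)" for i
    by (simp add: Cauchy_convergent_iff)
  then obtain l where l: "(\<lambda>n. s n i) \<longlonglongrightarrow> l i" for i
    unfolding convergent_def by metis
  have tail: "(\<lambda>i. s n i - l i) \<in> ell2 \<and> ell2_dist (s n) l \<le> \<epsilon>"
    if k: "\<forall>m\<ge>k. \<forall>n\<ge>k. ell2_dist (s m) (s n) < \<epsilon>" and n: "n \<ge> k" for k n \<epsilon>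
  proof -
    have \<epsilon>: "\<epsilon> > 0" using k n ell2_dist_nonneg by (meson le_less_trans)
    have "(\<Sum>i\<in>F. (s n i - l i)\<^sup>2) \<le> \<epsilon>\<^sup>2" if F: "finite F" for F
    proof (rule LIMSEQ_le_const2)
      show "(\<lambda>m. \<Sum>i\<in>F. (s n i - s m i)\<^sup>2) \<longlonglongrightarrow> (\<Sum>i\<in>F. (s n i - l i)\<^sup>2)"
        by (intro tendsto_intros l)
      show "\<exists>N. \<forall>m\<ge>N. (\<Sum>i\<in>F. (s n i - s m i)\<^sup>2) \<le> \<epsilon>\<^sup>2"
      proof (intro exI[of _ k] allI impI)
        fix m assume "m \<ge> k"
        then have "ell2_dist (s n) (s m) \<le> \<epsilon>" using k n by (simp add: less_imp_le)
        then have "(ell2_dist (s n) (s m))\<^sup>2 \<le> \<epsilon>\<^sup>2" using ell2_dist_nonneg by (intro power_mono)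
        then show "(\<Sum>i\<in>F. (s n i - s m i)\<^sup>2) \<le> \<epsilon>\<^sup>2"
          using ell2_sum_le_dist[OF sn[of n] sn[of m] F] by linarith
      qed
    qed
    from ell2_bounded_sums[OF this] show ?thesis
      using \<epsilon> by (auto simp: ell2_dist_conv intro: real_le_lsqrt)
  qed
  obtain k where "\<forall>m\<ge>k. \<forall>n\<ge>k. ell2_dist (s m) (s n) < 1"
    using cauchy zero_less_one by blast
  then have "(\<lambda>i. s k i - l i) \<in> ell2"
    using tail[of k 1 k] by blast
  then have lin: "l \<in> ell2"
    using ell2_diff_closed[OF sn[of k]] by fastforce
  have "(\<lambda>n. ell2_dist (s n) l) \<longlonglongrightarrow> 0"
  proof (rule LIMSEQ_I)
    fix r :: real assume "r > 0"
    then obtain k where "\<forall>m\<ge>k. \<forall>n\<ge>k. ell2_dist (s m) (s n) < r / 2"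
      using cauchy half_gt_zero by blast
    then have "norm (ell2_dist (s n) l - 0) < r" if "n \<ge> k" for n
      using tail[of k "r / 2" n] that ell2_dist_nonneg[of "s n" l] \<open>r > 0\<close> by simp
    then show "\<exists>no. \<forall>n\<ge>no. norm (ell2_dist (s n) l - 0) < r"
      by blast
  qed
  with lin show ?thesis by blast
qed

lemma ell2_hilbert_space:
  "real_hilbert_space (ell2 :: ('i \<Rightarrow> real) set) (\<lambda>i. 0) ell2_add ell2_scale ell2_inner"
proof
  fix x y z :: "'i \<Rightarrow> real" and a b :: real
  show "ell2_inner (ell2_add x y) z = ell2_inner x z + ell2_inner y z"
    if "x \<in> ell2" "y \<in> ell2" "z \<in> ell2"
    using infsum_add[OF ell2_mult_summable[OF that(1,3)] ell2_mult_summable[OF that(2,3)]]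
    by (simp add: ell2_inner_def ell2_add_def distrib_right)
  show "ell2_inner (ell2_scale a x) y = a * ell2_inner x y" if "x \<in> ell2" "y \<in> ell2"
    by (simp add: ell2_inner_def ell2_scale_def mult.assoc infsum_cmult_right')
  show "0 \<le> ell2_inner x x"
    by (auto simp: ell2_inner_def intro!: infsum_nonneg)
  show "x = (\<lambda>i. 0)" if "x \<in> ell2" "ell2_inner x x = 0"
  proof
    fix i
    show "x i = 0"
      using ell2_sum_le_inner[OF that(1), of "{i}"] that(2) by simp
  qed
qed (use ell2_complete in \<open>simp_all add: ell2_add_closed ell2_scale_closed\<close>,
     auto simp: ell2_add_def ell2_scale_def ell2_inner_def ell2_def algebra_simps)

section \<open>Coarse embedding into a Hilbert space\<close>

lemma coarse_embedding_of_lipschitz: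
  assumes sub: "\<psi> ` M \<subseteq> N" and C: "C \<ge> 0"
    and e0: "\<And>x y. \<lbrakk>x \<in> M; y \<in> M\<rbrakk> \<Longrightarrow> 0 \<le> e (\<psi> x) (\<psi> y)"
    and upper: "\<And>x y. \<lbrakk>x \<in> M; y \<in> M\<rbrakk> \<Longrightarrow> e (\<psi> x) (\<psi> y) \<le> C * d x y"
    and lower: "\<And>K. \<exists>T. \<forall>x\<in>M. \<forall>y\<in>M. d x y > T \<longrightarrow> K \<le> e (\<psi> x) (\<psi> y)"
  shows "coarse_embedding M d N e \<psi>"
proof -
  \<comment> \<open>\<open>Inf (A t)\<close> is the lower control function. The extra element
    \<open>max t 0\<close> makes it tend to infinity even if no pair of points is at distance at
    least \<open>t\<close>.\<close>
  define A where "A t = insert (max t 0) {e (\<psi> x) (\<psi> y) | x y. x \<in> M \<and> y \<in> M \<and> d x y \<ge> t}" for t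
  have A0: "0 \<le> a" if "a \<in> A t" for a t
    using that e0 by (auto simp: A_def)
  have ne: "A t \<noteq> {}" for t by (simp add: A_def)
  have bdd: "bdd_below (A t)" for t
    by (rule bdd_belowI[of _ 0]) (rule A0)
  show ?thesis
    unfolding coarse_embedding_def
  proof (intro conjI, goal_cases)
    case 2
    show ?case
    proof (rule exI[of _ "\<lambda>t. Inf (A t)"], rule exI[of _ "\<lambda>t. C * t"], intro conjI allI impI ballI)
      show "0 \<le> Inf (A t)" for t
        by (rule cInf_greatest[OF ne A0])
      show "0 \<le> C * t" if "t \<ge> 0" for t using C that by simp
      show "Inf (A (d x y)) \<le> e (\<psi> x) (\<psi> y)" if "x \<in> M" "y \<in> M" for x y
        using that by (intro cInf_lower bdd) (auto simp: A_def)
      show "filterlim (\<lambda>t. Inf (A t)) at_top at_top"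
        unfolding filterlim_at_top eventually_at_top_linorder
      proof
        fix K :: real
        obtain T where T: "\<forall>x\<in>M. \<forall>y\<in>M. d x y > T \<longrightarrow> K \<le> e (\<psi> x) (\<psi> y)"
          using lower by blast
        have "K \<le> Inf (A t)" if "t \<ge> max (T + 1) K" for t
          by (rule cInf_greatest[OF ne]) (use T that in \<open>auto simp: A_def\<close>)
        then show "\<exists>N. \<forall>t\<ge>N. K \<le> Inf (A t)" by blast
      qed
    qed (use upper in auto)
  qed (fact sub)
qed

lemma tent_lipschitz: "\<bar>max 0 (1 - a) - max 0 (1 - b)\<bar> \<le> \<bar>a - b\<bar>" for a b :: real
  by linarith

context pseudometric
begin

text \<open>At scale \<open>2 ^ k\<close> take the tent functions of the chain components; the tents over components
  of the same colour have disjoint supports. The differences of these functions from their values at a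
  base point are the coordinates of the embedding.\<close>

theorem coarse_dim_le_imp_hilbert_embedding:
  assumes dim: "coarse_dim_le M d m"
  shows "coarsely_embeds_into_hilbert_space M d"
proof -
  \<comment> \<open>The scale \<open>2 * 2 ^ k\<close> is twice the radius of the tents: points of
    two components that are both within \<open>2 ^ k\<close> of \<open>x\<close> are that close to
    each other.\<close>
  define P where "P k c l B \<longleftrightarrow> (\<forall>x\<in>M. c x \<le> m) \<and> 0 \<le> B \<and>
      (\<forall>x\<in>M. \<forall>y\<in>M. c x = c y \<longrightarrow> d x y \<le> 2 * 2 ^ k \<longrightarrow> l x = l y) \<and>
      (\<forall>x\<in>M. \<forall>y\<in>M. l x = l y \<longrightarrow> d x y \<le> B)" for k :: nat and c :: "'a \<Rightarrow> nat" and l :: "'a \<Rightarrow> 'a" and B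
  have "\<forall>k. \<exists>t. P k (fst t) (fst (snd t)) (snd (snd t))"
  proof
    fix k :: nat
    have pos: "(0::real) < 2 * 2 ^ k" by simp
    show "\<exists>t. P k (fst t) (fst (snd t)) (snd (snd t))"
    proof (rule coarse_dim_le_labelling[OF dim pos])
      fix c l B assume "\<And>x. x \<in> M \<Longrightarrow> c x \<le> m" "\<And>x. x \<in> M \<Longrightarrow> l x \<in> M" "(0::real) \<le> B"
        "\<And>x y. \<lbrakk>x \<in> M; y \<in> M; c x = c y; d x y \<le> 2 * 2 ^ k\<rbrakk> \<Longrightarrow> l x = l y"
        "\<And>x y. \<lbrakk>x \<in> M; y \<in> M; l x = l y\<rbrakk> \<Longrightarrow> c x = c y \<and> d x y \<le> B"
      then have "P k c l B" unfolding P_def by blast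
      then show ?thesis by (intro exI[of _ "(c, l, B)"]) simp
    qed
  qed
  then obtain t where t: "\<forall>k. P k (fst (t k)) (fst (snd (t k))) (snd (snd (t k)))"
    by (rule choice[THEN exE])
  define c where "c k = fst (t k)" for k
  define l where "l k = fst (snd (t k))" for k
  define B where "B k = snd (snd (t k))" for k
  have P: "P k (c k) (l k) (B k)" for k
    using t by (simp add: c_def l_def B_def)
  have c: "c k x \<le> m" if "x \<in> M" for k x using P[of k] that by (simp add: P_def)
  have B0: "0 \<le> B k" for k using P[of k] by (simp add: P_def)
  have near: "l k x = l k y" if "x \<in> M" "y \<in> M" "c k x = c k y" "d x y \<le> 2 * 2 ^ k" for k x y
    using P[of k] that unfolding P_def by blast
  have bdd: "d x y \<le> B k" if "x \<in> M" "y \<in> M" "l k x = l k y" for k x y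
    using P[of k] that unfolding P_def by blast
  \<comment> \<open>\<open>D k p x\<close> is the distance from \<open>x\<close> to the component
    named \<open>p\<close>. If \<open>p\<close> names none, \<open>E\<close> is empty, and
    \<open>\<phi>\<close> is set to 0.\<close>
  define E where "E k p x = {d x y | y. y \<in> M \<and> l k y = p}" for k p x
  define D where "D k p x = Inf (E k p x)" for k p x
  define \<phi> where "\<phi> k p x = (if p \<in> l k ` M then max 0 (1 - D k p x / 2 ^ k) else 0)" for k p x
  have E_bdd: "bdd_below (E k p x)" if "x \<in> M" for k p x
    using that nonneg by (auto simp: E_def intro!: bdd_belowI[of _ 0])
  have E_ne: "E k p x \<noteq> {}" if "p \<in> l k ` M" for k p x
    using that by (auto simp: E_def)
  have D_le: "D k (l k y) x \<le> d x y" if "x \<in> M" "y \<in> M" for k x y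
    unfolding D_def using that by (intro cInf_lower E_bdd) (auto simp: E_def)
  have D_ge: "t \<le> D k p x"
    if "p \<in> l k ` M" "\<And>y. y \<in> M \<Longrightarrow> l k y = p \<Longrightarrow> t \<le> d x y" for k p x t
    unfolding D_def using that(2) by (intro cInf_greatest E_ne[OF that(1)]) (auto simp: E_def)
  have D_lip: "D k p x \<le> D k p y + d x y" if "p \<in> l k ` M" "x \<in> M" "y \<in> M" for k p x y
  proof -
    have "D k p x - d x y \<le> D k p y"
    proof (rule D_ge[OF that(1)])
      fix z assume z: "z \<in> M" "l k z = p"
      then show "D k p x - d x y \<le> d y z"
        using D_le[of x z k] triangle[of x y z] that by auto
    qed
    then show ?thesis by simp
  qed
  have \<phi>_lip: "\<bar>\<phi> k p x - \<phi> k p y\<bar> \<le> d x y / 2 ^ k" if "x \<in> M" "y \<in> M" for k p x y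
  proof (cases "p \<in> l k ` M")
    case True
    have "\<bar>\<phi> k p x - \<phi> k p y\<bar> \<le> \<bar>D k p x / 2 ^ k - D k p y / 2 ^ k\<bar>"
      by (simp only: \<phi>_def True if_True tent_lipschitz)
    also have "\<dots> = \<bar>D k p x - D k p y\<bar> / 2 ^ k"
      by (simp add: diff_divide_distrib[symmetric] del: diff_divide_distrib)
    also have "\<dots> \<le> d x y / 2 ^ k"
      using D_lip[OF True that] D_lip[OF True that(2,1)] commute[OF that] by (intro divide_right_mono) auto
    finally show ?thesis .
  qed (use that nonneg in \<open>simp add: \<phi>_def\<close>)
  have \<phi>_self: "\<phi> k (l k x) x = 1" if "x \<in> M" for k x
  proof -
    have "D k (l k x) x = 0"
      using D_le[OF that that, of k] self[OF that] D_ge[of "l k x" k 0 x] that nonneg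
      by (intro order_antisym) auto
    then show ?thesis using that by (simp add: \<phi>_def)
  qed
  have \<phi>_far: "\<phi> k (l k x) y = 0" if "x \<in> M" "y \<in> M" "d x y > B k + 2 ^ k" for k x y
  proof -
    have "2 ^ k \<le> D k (l k x) y"
    proof (rule D_ge)
      fix z assume "z \<in> M" "l k z = l k x"
      then show "2 ^ k \<le> d y z"
        using bdd[of x z k] triangle[of x z y] commute[of y z] that by auto
    qed (use that in auto)
    then show ?thesis by (simp add: \<phi>_def)
  qed
  \<comment> \<open>Each tent that is nonzero at \<open>x\<close> has a component point within
    \<open>2 ^ k\<close> of \<open>x\<close>. Two such points of equal colour lie in one component
    by \<open>near\<close>, so the colours count the tents.\<close>
  have supp: "finite {p. \<phi> k p x \<noteq> 0} \<and> card {p. \<phi> k p x \<noteq> 0} \<le> Suc m" if x: "x \<in> M" for k x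
  proof -
    have "\<exists>y\<in>M. l k y = p \<and> d x y < 2 ^ k" if "\<phi> k p x \<noteq> 0" for p
    proof (rule ccontr)
      assume *: "\<not> ?thesis"
      have p: "p \<in> l k ` M" using that by (auto simp: \<phi>_def split: if_splits)
      have "2 ^ k \<le> D k p x" by (rule D_ge[OF p]) (use * in force)
      then show False using that by (simp add: \<phi>_def split: if_splits)
    qed
    then obtain g where g: "\<And>p. \<phi> k p x \<noteq> 0 \<Longrightarrow> g p \<in> M \<and> l k (g p) = p \<and> d x (g p) < 2 ^ k"
      by metis
    have inj: "inj_on (\<lambda>p. c k (g p)) {p. \<phi> k p x \<noteq> 0}"
    proof (rule inj_onI; clarsimp)
      fix p q assume p: "\<phi> k p x \<noteq> 0" and q: "\<phi> k q x \<noteq> 0" and eq: "c k (g p) = c k (g q)"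
      have "d (g p) (g q) \<le> d x (g p) + d x (g q)"
        using triangle[of "g p" x "g q"] commute[of x "g p"] g[OF p] g[OF q] x by auto
      then have "l k (g p) = l k (g q)"
        using g[OF p] g[OF q] eq by (intro near) auto
      then show "p = q" using g[OF p] g[OF q] by simp
    qed
    have sub: "(\<lambda>p. c k (g p)) ` {p. \<phi> k p x \<noteq> 0} \<subseteq> {..m}"
      using g c by auto
    show ?thesis
      using inj_on_finite[OF inj sub] card_inj_on_le[OF inj sub] by simp
  qed
  \<comment> \<open>At most \<open>2 * Suc m\<close> tents per scale are nonzero at \<open>x\<close>
    or \<open>y\<close>; the other factor 2 bounds the sum of the powers of 1/4.\<close>
  define C :: real where "C = 4 * real (Suc m)"
  have sums: "(\<Sum>(k, p)\<in>F. (\<phi> k p x - \<phi> k p y)\<^sup>2) \<le> C * (d x y)\<^sup>2"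
    if F: "finite F" and xy: "x \<in> M" "y \<in> M" for F x y
  proof -
    define S where "S k = {p. \<phi> k p x \<noteq> 0} \<union> {p. \<phi> k p y \<noteq> 0}" for k
    have S: "finite (S k)" "real (card (S k)) \<le> 2 * real (Suc m)" for k
    proof -
      show "finite (S k)" using supp xy by (simp add: S_def)
      have "card (S k) \<le> 2 * Suc m"
        unfolding S_def using card_Un_le[of "{p. \<phi> k p x \<noteq> 0}" "{p. \<phi> k p y \<noteq> 0}"] supp[of x k]
          supp[of y k] xy by auto
      then show "real (card (S k)) \<le> 2 * real (Suc m)" by linarith
    qed
    define T where "T = fst ` F"
    have finT: "finite T" using F by (simp add: T_def)
    obtain K where K: "T \<subseteq> {..<K}" using finite_nat_iff_bounded finT by blast
    have "(\<Sum>(k, p)\<in>F. (\<phi> k p x - \<phi> k p y)\<^sup>2) = (\<Sum>(k, p)\<in>F \<inter> Sigma T S. (\<phi> k p x - \<phi> k p y)\<^sup>2)"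
    proof (rule sum.mono_neutral_right[OF F])
      show "\<forall>i\<in>F - F \<inter> Sigma T S. (case i of (k, p) \<Rightarrow> (\<phi> k p x - \<phi> k p y)\<^sup>2) = 0"
        by (force simp: S_def T_def)
    qed auto
    also have "\<dots> \<le> (\<Sum>(k, p)\<in>Sigma T S. (\<phi> k p x - \<phi> k p y)\<^sup>2)"
      using finT S by (intro sum_mono2) auto
    also have "\<dots> = (\<Sum>k\<in>T. \<Sum>p\<in>S k. (\<phi> k p x - \<phi> k p y)\<^sup>2)"
      using finT S by (subst sum.Sigma) auto
    also have "\<dots> \<le> (\<Sum>k\<in>T. 2 * real (Suc m) * (d x y)\<^sup>2 * (1 / 4) ^ k)"
    proof (rule sum_mono)
      fix k
      have "(\<Sum>p\<in>S k. (\<phi> k p x - \<phi> k p y)\<^sup>2) \<le> (\<Sum>p\<in>S k. (d x y / 2 ^ k)\<^sup>2)"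
      proof (rule sum_mono)
        fix p
        show "(\<phi> k p x - \<phi> k p y)\<^sup>2 \<le> (d x y / 2 ^ k)\<^sup>2"
          using power_mono[OF \<phi>_lip[OF xy, of k p], of 2] by simp
      qed
      also have "\<dots> = real (card (S k)) * (d x y / 2 ^ k)\<^sup>2" by simp
      also have "\<dots> \<le> 2 * real (Suc m) * (d x y / 2 ^ k)\<^sup>2"
        by (intro mult_right_mono S) simp
      also have "\<dots> = 2 * real (Suc m) * (d x y)\<^sup>2 * (1 / 4) ^ k"
        by (simp add: power_divide power2_eq_square power_mult_distrib[symmetric])
      finally show "(\<Sum>p\<in>S k. (\<phi> k p x - \<phi> k p y)\<^sup>2) \<le> 2 * real (Suc m) * (d x y)\<^sup>2 * (1 / 4) ^ k" .
    qed
    also have "\<dots> \<le> (\<Sum>k<K. 2 * real (Suc m) * (d x y)\<^sup>2 * (1 / 4) ^ k)"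
      using K by (intro sum_mono2) auto
    also have "\<dots> = 2 * real (Suc m) * (d x y)\<^sup>2 * (\<Sum>k<K. (1 / 4) ^ k)"
      by (simp add: sum_distrib_left)
    also have "\<dots> \<le> 2 * real (Suc m) * (d x y)\<^sup>2 * 2"
    proof (rule mult_left_mono)
      show "(\<Sum>k<K. (1 / 4) ^ k) \<le> (2::real)"
        by (subst geometric_sum) (simp_all add: field_simps)
    qed simp
    finally show ?thesis by (simp add: C_def algebra_simps)
  qed
  define x0 where "x0 = (SOME x. x \<in> M)"
  \<comment> \<open>By \<open>\<phi>_self\<close> the values at one point contain a 1 at every
    scale, so they are not square-summable; only differences are.\<close>
  define \<psi> where "\<psi> x = (\<lambda>(k, p). \<phi> k p x - \<phi> k p x0)" for x
  have diff: "(\<lambda>i. \<psi> x i - \<psi> y i) = (\<lambda>(k, p). \<phi> k p x - \<phi> k p y)" for x y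
    by (auto simp: \<psi>_def fun_eq_iff)
  have in_ell2: "(\<lambda>(k, p). \<phi> k p x - \<phi> k p y) \<in> ell2"
    and inner: "ell2_inner (\<lambda>(k, p). \<phi> k p x - \<phi> k p y) (\<lambda>(k, p). \<phi> k p x - \<phi> k p y) \<le> C * (d x y)\<^sup>2"
    if "x \<in> M" "y \<in> M" for x y
  proof -
    have "(\<Sum>i\<in>F. ((\<lambda>(k, p). \<phi> k p x - \<phi> k p y) i)\<^sup>2) \<le> C * (d x y)\<^sup>2" if "finite F" for F
      using sums[OF that \<open>x \<in> M\<close> \<open>y \<in> M\<close>] by (simp add: case_prod_unfold)
    from ell2_bounded_sums[OF this] show
      "(\<lambda>(k, p). \<phi> k p x - \<phi> k p y) \<in> ell2"
      "ell2_inner (\<lambda>(k, p). \<phi> k p x - \<phi> k p y) (\<lambda>(k, p). \<phi> k p x - \<phi> k p y) \<le> C * (d x y)\<^sup>2"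
      by blast+
  qed
  have \<psi>_ell2: "\<psi> x \<in> ell2" if "x \<in> M" for x
    unfolding \<psi>_def using that someI[of "\<lambda>x. x \<in> M" x] by (intro in_ell2) (simp_all add: x0_def)
  have "coarse_embedding M d ell2 ell2_dist \<psi>"
  proof (rule coarse_embedding_of_lipschitz)
    show "\<psi> ` M \<subseteq> ell2" using \<psi>_ell2 by auto
    show "0 \<le> sqrt C" by (simp add: C_def)
    show "0 \<le> ell2_dist (\<psi> x) (\<psi> y)" for x y by (rule ell2_dist_nonneg)
    show "ell2_dist (\<psi> x) (\<psi> y) \<le> sqrt C * d x y" if "x \<in> M" "y \<in> M" for x y
    proof -
      have "ell2_dist (\<psi> x) (\<psi> y) \<le> sqrt (C * (d x y)\<^sup>2)"
        unfolding ell2_dist_conv diff using inner[OF that] by (rule real_sqrt_le_mono)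
      then show ?thesis using nonneg[OF that] by (simp add: real_sqrt_mult)
    qed
    fix K :: real
    \<comment> \<open>Beyond \<open>T\<close>, each of the first \<open>n\<close> scales contributes
      1 to the squared distance: the tent of the component of \<open>x\<close> is 1 at
      \<open>x\<close> and 0 at \<open>y\<close>.\<close>
    define n where "n = nat \<lceil>K\<^sup>2\<rceil>"
    define T where "T = (\<Sum>k<n. B k + 2 ^ k)"
    have "K \<le> ell2_dist (\<psi> x) (\<psi> y)" if xy: "x \<in> M" "y \<in> M" "d x y > T" for x y
    proof -
      have far: "d x y > B k + 2 ^ k" if "k < n" for k
      proof -
        have "B k + 2 ^ k \<le> T"
          unfolding T_def using that B0 by (intro member_le_sum) auto
        then show ?thesis using xy(3) by simp
      qed
      have "K\<^sup>2 \<le> real n" unfolding n_def by linarith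
      also have "real n = (\<Sum>k<n. (\<phi> k (l k x) x - \<phi> k (l k x) y)\<^sup>2)"
        using \<phi>_self[OF xy(1)] \<phi>_far[OF xy(1,2) far] by simp
      also have "\<dots> = (\<Sum>i\<in>(\<lambda>k. (k, l k x)) ` {..<n}. (\<psi> x i - \<psi> y i)\<^sup>2)"
        by (subst sum.reindex) (auto simp: inj_on_def \<psi>_def)
      also have "\<dots> \<le> (ell2_dist (\<psi> x) (\<psi> y))\<^sup>2"
        using xy by (intro ell2_sum_le_dist \<psi>_ell2) auto
      finally show ?thesis
        using ell2_dist_nonneg by (rule power2_le_imp_le)
    qed
    then show "\<exists>T. \<forall>x\<in>M. \<forall>y\<in>M. d x y > T \<longrightarrow> K \<le> ell2_dist (\<psi> x) (\<psi> y)" by blast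
  qed
  then show ?thesis
    unfolding coarsely_embeds_into_hilbert_space_def using ell2_hilbert_space by blast
qed

end

section \<open>Gromov--Hausdorff distance and distortion of correspondences\<close>

definition distortion_le :: "'a metric \<Rightarrow> 'b metric \<Rightarrow> ('a \<times> 'b) set \<Rightarrow> real \<Rightarrow> bool" where
  "distortion_le X Y R e \<longleftrightarrow>
     (\<forall>(x, y)\<in>R. \<forall>(x', y')\<in>R. \<bar>mdist X x x' - mdist Y y y'\<bar> \<le> e)"

lemma distortion_leD:
  "\<lbrakk>distortion_le X Y R e; (x, y) \<in> R; (x', y') \<in> R\<rbrakk> \<Longrightarrow> \<bar>mdist X x x' - mdist Y y y'\<bar> \<le> e"
  by (fastforce simp: distortion_le_def)

lemma distortion_leI:
  "(\<And>x y x' y'. \<lbrakk>(x, y) \<in> R; (x', y') \<in> R\<rbrakk> \<Longrightarrow> \<bar>mdist X x x' - mdist Y y y'\<bar> \<le> e)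
    \<Longrightarrow> distortion_le X Y R e"
  by (auto simp: distortion_le_def)

text \<open>The two spaces are glued along \<open>R\<close>, related points being placed at distance \<open>e\<close>.\<close>

lemma gh_distance_le_distortion:
  fixes X :: "'a metric" and Y :: "'b metric"
  assumes R: "correspondence (mspace X) (mspace Y) R" and ne: "R \<noteq> {}"
    and dis: "distortion_le X Y R (2 * e)" and e: "e > 0"
  shows "gh_distance X Y \<le> ennreal e"
proof -
  \<comment> \<open>\<open>g x y\<close> is the infimal length of a path from \<open>x\<close> to
    \<open>y\<close> through a related pair, the crossing costing \<open>e\<close>. As
    \<open>e\<close> is positive, points of the two spaces stay distinct.\<close>
  define G where "G x y = (\<lambda>(x', y'). mdist X x x' + mdist Y y' y) ` R" for x y
  define g where "g x y = Inf (G x y) + e" for x y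
  define D :: "'a + 'b \<Rightarrow> 'a + 'b \<Rightarrow> real" where
    "D p q = (case (p, q) of (Inl x, Inl x') \<Rightarrow> mdist X x x' | (Inr y, Inr y') \<Rightarrow> mdist Y y y'
       | (Inl x, Inr y) \<Rightarrow> g x y | (Inr y, Inl x) \<Rightarrow> g x y)" for p q
  define S where "S = Inl ` mspace X \<union> Inr ` mspace Y"
  have Rsub: "x \<in> mspace X" "y \<in> mspace Y" if "(x, y) \<in> R" for x y
    using R that by (auto simp: correspondence_def)
  have Gne: "G x y \<noteq> {}" for x y using ne by (auto simp: G_def)
  have Gbdd: "bdd_below (G x y)" for x y
    by (rule bdd_belowI[of _ 0]) (auto simp: G_def)
  have G0: "Inf (G x y) \<ge> 0" for x y
    by (rule cInf_greatest[OF Gne]) (auto simp: G_def)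
  have gpos: "g x y > 0" for x y
    using G0[of x y] e by (simp add: g_def)
  have gle: "g x y \<le> mdist X x x' + mdist Y y' y + e" if "(x', y') \<in> R" for x y x' y'
    unfolding g_def using that by (auto simp: G_def intro!: cInf_lower Gbdd[unfolded G_def] rev_image_eqI)
  have gge: "c \<le> g x y" if "\<And>x' y'. (x', y') \<in> R \<Longrightarrow> c \<le> mdist X x x' + mdist Y y' y + e" for c x y
  proof -
    have "c - e \<le> Inf (G x y)"
      by (rule cInf_greatest[OF Gne]) (use that in \<open>force simp: G_def\<close>)
    then show ?thesis by (simp add: g_def)
  qed
  have gX: "g x y \<le> mdist X x x2 + g x2 y" if "x \<in> mspace X" "x2 \<in> mspace X" for x x2 y
  proof -
    have "g x y - mdist X x x2 \<le> g x2 y"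
    proof (rule gge)
      fix x' y' assume "(x', y') \<in> R"
      then show "g x y - mdist X x x2 \<le> mdist X x2 x' + mdist Y y' y + e"
        using gle[of x' y' x y] mdist_triangle[of x X x2 x'] that Rsub by force
    qed
    then show ?thesis by simp
  qed
  have gY: "g x y \<le> g x y2 + mdist Y y2 y" if "y \<in> mspace Y" "y2 \<in> mspace Y" for x y y2
  proof -
    have "g x y - mdist Y y2 y \<le> g x y2"
    proof (rule gge)
      fix x' y' assume "(x', y') \<in> R"
      then show "g x y - mdist Y y2 y \<le> mdist X x x' + mdist Y y' y2 + e"
        using gle[of x' y' x y] mdist_triangle[of y' Y y2 y] that Rsub by force
    qed
    then show ?thesis by simp
  qed
  \<comment> \<open>Going over to \<open>Y\<close> and back must not be a shortcut: the two
    crossings cost \<open>2 * e\<close>, which pays for the distortion between the two pairs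
    used.\<close>
  have XX: "mdist X x x2 \<le> g x y + g x2 y"
    if "x \<in> mspace X" "x2 \<in> mspace X" "y \<in> mspace Y" for x x2 y
  proof -
    have "mdist X x x2 - g x y \<le> g x2 y"
    proof (rule gge)
      fix a b assume ab: "(a, b) \<in> R"
      have "mdist X x x2 - (mdist X x2 a + mdist Y b y + e) \<le> g x y"
      proof (rule gge)
        fix a' b' assume ab': "(a', b') \<in> R"
        have "mdist X x x2 \<le> mdist X x a' + mdist X a' a + mdist X x2 a"
          using mdist_triangle[of x X a' x2] mdist_triangle[of a' X a x2] that Rsub ab ab'
          by (force simp: mdist_commute)
        moreover have "mdist Y b' b \<le> mdist Y b' y + mdist Y b y"
          using mdist_triangle[of b' Y y b] that Rsub ab ab' by (force simp: mdist_commute)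
        moreover have "\<bar>mdist X a' a - mdist Y b' b\<bar> \<le> 2 * e"
          using distortion_leD[OF dis ab' ab] .
        ultimately show "mdist X x x2 - (mdist X x2 a + mdist Y b y + e) \<le> mdist X x a' + mdist Y b' y + e"
          by linarith
      qed
      then show "mdist X x x2 - g x y \<le> mdist X x2 a + mdist Y b y + e" by linarith
    qed
    then show ?thesis by simp
  qed
  have YY: "mdist Y y y2 \<le> g x y + g x y2"
    if "x \<in> mspace X" "y2 \<in> mspace Y" "y \<in> mspace Y" for x y y2
  proof -
    have "mdist Y y y2 - g x y \<le> g x y2"
    proof (rule gge)
      fix a b assume ab: "(a, b) \<in> R"
      have "mdist Y y y2 - (mdist X x a + mdist Y b y2 + e) \<le> g x y"
      proof (rule gge)
        fix a' b' assume ab': "(a', b') \<in> R"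
        have "mdist Y y y2 \<le> mdist Y b' y + mdist Y b' b + mdist Y b y2"
          using mdist_triangle[of y Y b' y2] mdist_triangle[of b' Y b y2] that Rsub ab ab'
          by (force simp: mdist_commute)
        moreover have "mdist X a' a \<le> mdist X x a' + mdist X x a"
          using mdist_triangle[of a' X x a] that Rsub ab ab' by (force simp: mdist_commute)
        moreover have "\<bar>mdist X a' a - mdist Y b' b\<bar> \<le> 2 * e"
          using distortion_leD[OF dis ab' ab] .
        ultimately show "mdist Y y y2 - (mdist X x a + mdist Y b y2 + e) \<le> mdist X x a' + mdist Y b' y + e"
          by linarith
      qed
      then show "mdist Y y y2 - g x y \<le> mdist X x a + mdist Y b y2 + e" by linarith
    qed
    then show ?thesis by simp
  qed
  interpret S: Metric_space S D
  proof
    fix p q r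
    show "0 \<le> D p q"
      using gpos by (auto simp: D_def less_imp_le split: sum.splits)
    show "D p q = D q p"
      by (auto simp: D_def mdist_commute split: sum.splits)
    show "D p q = 0 \<longleftrightarrow> p = q" if "p \<in> S" "q \<in> S"
      using that gpos by (auto simp: D_def S_def less_imp_neq[THEN not_sym] split: sum.splits)
    show "D p r \<le> D p q + D q r" if "p \<in> S" "q \<in> S" "r \<in> S"
    proof -
      have tri: "D p r \<le> D p q + D q r"
        if "p = Inl x \<and> x \<in> mspace X \<or> p = Inr y \<and> y \<in> mspace Y"
          "q = Inl x' \<and> x' \<in> mspace X \<or> q = Inr y' \<and> y' \<in> mspace Y"
          "r = Inl x'' \<and> x'' \<in> mspace X \<or> r = Inr y'' \<and> y'' \<in> mspace Y"
        for x y x' y' x'' y''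
        using that
      proof (elim disjE conjE)
      qed (use mdist_triangle[of x X x' x''] mdist_triangle[of y Y y' y''] gX[of x x' y'']
             gX[of x'' x' y] gY[of y y' x''] gY[of y'' y' x] XX[of x x'' y'] YY[of x' y'' y]
           in \<open>simp_all add: D_def mdist_commute add.commute\<close>)
      obtain x y x' y' x'' y'' where
          "p = Inl x \<and> x \<in> mspace X \<or> p = Inr y \<and> y \<in> mspace Y"
          "q = Inl x' \<and> x' \<in> mspace X \<or> q = Inr y' \<and> y' \<in> mspace Y"
          "r = Inl x'' \<and> x'' \<in> mspace X \<or> r = Inr y'' \<and> y'' \<in> mspace Y"
        using \<open>p \<in> S\<close> \<open>q \<in> S\<close> \<open>r \<in> S\<close> unfolding S_def by blast
      then show ?thesis by (rule tri)
    qed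
  qed
  define Z where "Z = metric (S, D)"
  have sp: "mspace Z = S" and di: "mdist Z = D" unfolding Z_def by simp_all
  have "isometric_embedding X Z Inl" "isometric_embedding Y Z Inr"
    by (auto simp: isometric_embedding_def sp di S_def D_def)
  then have "gh_distance X Y \<le> hausdorff_distance Z (Inl ` mspace X) (Inr ` mspace Y)"
    by (rule gh_distance_le)
  also have "\<dots> \<le> (SUP (p, q)\<in>map_prod Inl Inr ` R. ennreal (mdist Z p q))"
    unfolding hausdorff_distance_def
  proof (rule INF_lower)
    show "map_prod Inl Inr ` R \<in> {Ra. correspondence (Inl ` mspace X) (Inr ` mspace Y) Ra}"
      using R unfolding correspondence_def by fastforce
  qed
  also have "\<dots> \<le> ennreal e"
  proof (rule SUP_least)
    fix t assume "t \<in> map_prod (Inl :: 'a \<Rightarrow> 'a + 'b) (Inr :: 'b \<Rightarrow> 'a + 'b) ` R"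
    then obtain x y where xy: "(x, y) \<in> R" "t = (Inl x, Inr y)" by auto
    have "mdist X x x = 0" "mdist Y y y = 0" using Rsub[OF xy(1)] by simp_all
    then have "g x y \<le> e" using gle[OF xy(1), of x y] by simp
    then show "(case t of (p, q) \<Rightarrow> ennreal (mdist Z p q)) \<le> ennreal e"
      by (simp add: xy(2) di D_def ennreal_leI)
  qed
  finally show ?thesis .
qed

text \<open>The strict inequality provides an ambient space and a correspondence below the bound.
  Moving both ends of a pair of points by at most \<open>e\<close> changes their distance by at most
  \<open>2 * e\<close>.\<close>

lemma distortion_le_gh_distance:
  fixes X :: "'a metric" and Y :: "'b metric"
  assumes "gh_distance X Y < ennreal e"
  obtains R where "correspondence (mspace X) (mspace Y) R" "distortion_le X Y R (2 * e)"
proof -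
  obtain Z :: "('a + 'b) metric" and i j where i: "isometric_embedding X Z i"
    and j: "isometric_embedding Y Z j"
    and lt: "hausdorff_distance Z (i ` mspace X) (j ` mspace Y) < ennreal e"
    using assms unfolding gh_distance_def Inf_less_iff by blast
  obtain R where R: "correspondence (i ` mspace X) (j ` mspace Y) R"
    and Re: "(SUP (x, y)\<in>R. ennreal (mdist Z x y)) < ennreal e"
    using lt unfolding hausdorff_distance_def INF_less_iff by blast
  have near: "mdist Z p q \<le> e" if "(p, q) \<in> R" for p q
  proof -
    have "ennreal (mdist Z p q) \<le> (SUP (x, y)\<in>R. ennreal (mdist Z x y))"
      using that by (auto intro!: SUP_upper2[of "(p, q)"])
    then have "ennreal (mdist Z p q) < ennreal e" using Re by (rule le_less_trans)
    then show ?thesis by (simp add: ennreal_less_iff)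
  qed
  define R' where "R' = {(x, y). x \<in> mspace X \<and> y \<in> mspace Y \<and> (i x, j y) \<in> R}"
  have "correspondence (mspace X) (mspace Y) R'"
    unfolding correspondence_def
  proof (intro conjI ballI)
    show "R' \<subseteq> mspace X \<times> mspace Y" by (auto simp: R'_def)
  next
    fix x assume x: "x \<in> mspace X"
    then obtain b where "b \<in> j ` mspace Y" "(i x, b) \<in> R"
      using R unfolding correspondence_def by blast
    with x show "\<exists>y\<in>mspace Y. (x, y) \<in> R'" by (auto simp: R'_def)
  next
    fix y assume y: "y \<in> mspace Y"
    then obtain b where "b \<in> i ` mspace X" "(b, j y) \<in> R"
      using R unfolding correspondence_def by blast
    with y show "\<exists>x\<in>mspace X. (x, y) \<in> R'" by (auto simp: R'_def)
  qed
  moreover have "distortion_le X Y R' (2 * e)"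
  proof (rule distortion_leI)
    fix x y x' y' assume xy: "(x, y) \<in> R'" and xy': "(x', y') \<in> R'"
    have mem: "i x \<in> mspace Z" "i x' \<in> mspace Z" "j y \<in> mspace Z" "j y' \<in> mspace Z"
      and eq: "mdist X x x' = mdist Z (i x) (i x')" "mdist Y y y' = mdist Z (j y) (j y')"
      using xy xy' i j by (auto simp: R'_def isometric_embedding_def)
    have "mdist Z (i x) (j y) \<le> e" "mdist Z (i x') (j y') \<le> e"
      using xy xy' near by (auto simp: R'_def)
    then show "\<bar>mdist X x x' - mdist Y y y'\<bar> \<le> 2 * e"
      unfolding eq
      using mdist_triangle[of "i x" Z "j y" "i x'"] mdist_triangle[of "j y" Z "j y'" "i x'"]
        mdist_triangle[of "j y" Z "i x" "j y'"] mdist_triangle[of "i x" Z "i x'" "j y'"] mem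
      by (simp add: mdist_commute abs_le_iff)
  qed
  ultimately show thesis by (rule that)
qed

section \<open>The real-valued distance of finite metric spaces\<close>

definition finite_metrics :: "nat metric set" where
  "finite_metrics = {X. mspace X \<noteq> {} \<and> finite (mspace X)}"

definition gh :: "nat metric \<Rightarrow> nat metric \<Rightarrow> real" where
  "gh X Y = enn2real (gh_distance X Y)"

lemma gh_nonneg: "gh X Y \<ge> 0" by (simp add: gh_def)

text \<open>Gluing requires a positive constant; adding \<open>\<epsilon>\<close> also covers
  \<open>e = 0\<close>, which is the case of isometric spaces.\<close>

lemma gh_leI:
  assumes "X \<in> finite_metrics" "correspondence (mspace X) (mspace Y) R"
    and dis: "distortion_le X Y R (2 * e)" "e \<ge> 0"
  shows "gh X Y \<le> e"
proof (rule field_le_epsilon)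
  fix \<epsilon> :: real assume "\<epsilon> > 0"
  moreover have "distortion_le X Y R (2 * (e + \<epsilon>))"
    using dis \<open>\<epsilon> > 0\<close> by (intro distortion_leI) (smt (verit) distortion_leD)
  moreover have "R \<noteq> {}"
    using assms(1,2) by (auto simp: correspondence_def finite_metrics_def)
  ultimately have "gh_distance X Y \<le> ennreal (e + \<epsilon>)"
    using assms by (intro gh_distance_le_distortion) auto
  then show "gh X Y \<le> e + \<epsilon>"
    unfolding gh_def using assms(4) \<open>\<epsilon> > 0\<close> by (intro enn2real_leI) auto
qed

text \<open>The full product is a correspondence whose distortion is at most the larger
  diameter.\<close>

lemma gh_distance_finite:
  assumes X: "X \<in> finite_metrics" and Y: "Y \<in> finite_metrics"
  shows "gh_distance X Y < \<infinity>"
proof -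
  obtain B where B: "\<And>x x'. x \<in> mspace X \<Longrightarrow> x' \<in> mspace X \<Longrightarrow> mdist X x x' \<le> B"
    using bdd_above_finite[of "(\<lambda>(x, x'). mdist X x x') ` (mspace X \<times> mspace X)"] X
    by (auto simp: finite_metrics_def bdd_above_def)
  obtain B' where B': "\<And>x x'. x \<in> mspace Y \<Longrightarrow> x' \<in> mspace Y \<Longrightarrow> mdist Y x x' \<le> B'"
    using bdd_above_finite[of "(\<lambda>(x, x'). mdist Y x x') ` (mspace Y \<times> mspace Y)"] Y
    by (auto simp: finite_metrics_def bdd_above_def)
  define e where "e = max B B' + 1"
  have "e > 0"
    using X B mdist_nonneg[of X] unfolding e_def finite_metrics_def
    by (smt (verit) mem_Collect_eq ex_in_conv)
  have "gh_distance X Y \<le> ennreal e"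
  proof (rule gh_distance_le_distortion)
    show "correspondence (mspace X) (mspace Y) (mspace X \<times> mspace Y)"
      "mspace X \<times> mspace Y \<noteq> {}"
      using X Y by (auto simp: correspondence_def finite_metrics_def)
    show "distortion_le X Y (mspace X \<times> mspace Y) (2 * e)"
    proof (rule distortion_leI)
      fix x y x' y' assume "(x, y) \<in> mspace X \<times> mspace Y" "(x', y') \<in> mspace X \<times> mspace Y"
      then show "\<bar>mdist X x x' - mdist Y y y'\<bar> \<le> 2 * e"
        using B[of x x'] B'[of y y'] mdist_nonneg[of X x x'] mdist_nonneg[of Y y y'] \<open>e > 0\<close>
        unfolding e_def mem_Sigma_iff by (smt (verit, best))
    qed
  qed fact
  then show ?thesis by (simp add: le_less_trans)
qed

text \<open>Finiteness matters here: \<open>enn2real\<close> would send an infinite distance to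
  0.\<close>

lemma gh_lessE:
  assumes "X \<in> finite_metrics" "Y \<in> finite_metrics" "gh X Y < e"
  obtains R where "correspondence (mspace X) (mspace Y) R" "distortion_le X Y R (2 * e)"
proof (rule distortion_le_gh_distance)
  show "gh_distance X Y < ennreal e"
    using assms gh_distance_finite[OF assms(1,2)]
    by (metis enn2real_nonneg ennreal_enn2real ennreal_less_iff gh_def infinity_ennreal_def)
qed (use that in blast)

lemma correspondence_converse:
  "correspondence A B R \<Longrightarrow> correspondence B A (R\<inverse>)"
  by (auto simp: correspondence_def)

lemma gh_commute_le:
  assumes "X \<in> finite_metrics" "Y \<in> finite_metrics"
  shows "gh Y X \<le> gh X Y"
proof (rule field_le_epsilon)
  fix \<epsilon> :: real assume "\<epsilon> > 0"
  then obtain R where R: "correspondence (mspace X) (mspace Y) R"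
    and d: "distortion_le X Y R (2 * (gh X Y + \<epsilon>))"
    using gh_lessE[OF assms, of "gh X Y + \<epsilon>"] by auto
  have "distortion_le Y X (R\<inverse>) (2 * (gh X Y + \<epsilon>))"
    using d by (intro distortion_leI) (metis abs_minus_commute converse_iff distortion_leD)
  then show "gh Y X \<le> gh X Y + \<epsilon>"
    using gh_leI[OF assms(2) correspondence_converse[OF R]] \<open>\<epsilon> > 0\<close> gh_nonneg[of X Y] by simp
qed

lemma gh_commute:
  assumes "X \<in> finite_metrics" "Y \<in> finite_metrics"
  shows "gh X Y = gh Y X"
  using gh_commute_le assms by (meson order_antisym)

lemma gh_isometric:
  assumes "X \<in> finite_metrics" "isometric X Y"
  shows "gh X Y = 0"
proof -
  obtain f where f: "isometric_embedding X Y f" "f ` mspace X = mspace Y"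
    using assms(2) by (auto simp: isometric_def)
  have "gh X Y \<le> 0"
  proof (rule gh_leI[OF assms(1)])
    show "correspondence (mspace X) (mspace Y) ((\<lambda>x. (x, f x)) ` mspace X)"
      using f(2) by (fastforce simp: correspondence_def)
    show "distortion_le X Y ((\<lambda>x. (x, f x)) ` mspace X) (2 * 0)"
      using f by (intro distortion_leI) (auto simp: isometric_embedding_def)
  qed simp
  then show ?thesis using gh_nonneg[of X Y] by simp
qed

lemma isometric_refl: "isometric X X"
  unfolding isometric_def isometric_embedding_def by (rule exI[of _ id]) auto

lemma gh_self: "X \<in> finite_metrics \<Longrightarrow> gh X X = 0"
  by (simp add: gh_isometric isometric_refl)

lemma gh_triangle:
  assumes X: "X \<in> finite_metrics" and Y: "Y \<in> finite_metrics" and Z: "Z \<in> finite_metrics"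
  shows "gh X Z \<le> gh X Y + gh Y Z"
proof (rule field_le_epsilon)
  fix \<epsilon> :: real assume \<epsilon>: "\<epsilon> > 0"
  obtain R where R: "correspondence (mspace X) (mspace Y) R"
    and dR: "distortion_le X Y R (2 * (gh X Y + \<epsilon> / 2))"
    using gh_lessE[OF X Y, of "gh X Y + \<epsilon> / 2"] \<epsilon> by auto
  obtain S where S: "correspondence (mspace Y) (mspace Z) S"
    and dS: "distortion_le Y Z S (2 * (gh Y Z + \<epsilon> / 2))"
    using gh_lessE[OF Y Z, of "gh Y Z + \<epsilon> / 2"] \<epsilon> by auto
  show "gh X Z \<le> gh X Y + gh Y Z + \<epsilon>"
  proof (rule gh_leI[OF X])
    show "correspondence (mspace X) (mspace Z) (R O S)"
      using R S unfolding correspondence_def by (fastforce simp: relcomp_unfold)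
    show "distortion_le X Z (R O S) (2 * (gh X Y + gh Y Z + \<epsilon>))"
    proof (rule distortion_leI)
      fix x z x' z' assume "(x, z) \<in> R O S" "(x', z') \<in> R O S"
      then obtain y y' where "(x, y) \<in> R" "(y, z) \<in> S" "(x', y') \<in> R" "(y', z') \<in> S" by blast
      then show "\<bar>mdist X x x' - mdist Z z z'\<bar> \<le> 2 * (gh X Y + gh Y Z + \<epsilon>)"
        using distortion_leD[OF dR, of x y x' y'] distortion_leD[OF dS, of y z y' z'] by (simp add: abs_le_iff)
    qed
    show "0 \<le> gh X Y + gh Y Z + \<epsilon>"
      using \<epsilon> gh_nonneg[of X Y] gh_nonneg[of Y Z] by simp
  qed
qed

section \<open>Lower bound\<close>

text \<open>A discrete form of Lebesgue's covering theorem: \<open>u x\<close> is the member of the cover assigned to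
  the grid point \<open>x\<close> and \<open>c x\<close> the family to which it belongs. Labelling \<open>x\<close> by the first
  direction in which \<open>u x\<close> reaches the far face, Kuhn's lemma yields mutually adjacent points with
  all \<open>N + 1\<close> labels.\<close>

lemma grid_covering_dimension:
  fixes N p m :: nat and c :: "(nat \<Rightarrow> nat) \<Rightarrow> nat" and u :: "(nat \<Rightarrow> nat) \<Rightarrow> 'u"
  defines "grid \<equiv> {x. \<forall>j. x j \<le> p}"
  assumes p: "p > 0"
    and col: "\<And>x. x \<in> grid \<Longrightarrow> c x \<le> m"
    and near: "\<And>x y. \<lbrakk>x \<in> grid; y \<in> grid; c x = c y; \<And>j. x j \<le> y j + 1 \<and> y j \<le> x j + 1\<rbrakk>
                 \<Longrightarrow> u x = u y"
    and small: "\<And>x y j. \<lbrakk>x \<in> grid; y \<in> grid; u x = u y; j < N; x j = 0\<rbrakk> \<Longrightarrow> y j \<noteq> p"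
  shows "N \<le> m"
proof -
  define lab :: "(nat \<Rightarrow> nat) \<Rightarrow> nat \<Rightarrow> nat"
    where "lab x j = (if \<exists>y\<in>grid. u y = u x \<and> y j = p then 1 else 0)" for x j
  have lab_cong: "lab x = lab y" if "u x = u y" for x y :: "nat \<Rightarrow> nat"
    using that by (auto simp: lab_def)
  have "odd (card {s. ksimplex p N s \<and> (reduced N \<circ> lab) ` s = {..N}})"
  proof (rule kuhn_combinatorial[OF p]; intro allI impI; elim conjE)
    fix x :: "nat \<Rightarrow> nat" and j assume x: "\<forall>j. x j \<le> p" and j: "j < N"
    then have xg: "x \<in> grid" by (simp add: grid_def)
    show "lab x j = 0" if "x j = 0"
      using small[OF xg _ _ j that] by (auto simp: lab_def)
    show "lab x j = 1" if "x j = p"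
      using xg that by (auto simp: lab_def)
  qed
  then have "{s. ksimplex p N s \<and> (reduced N \<circ> lab) ` s = {..N}} \<noteq> {}"
    by (rule odd_card_imp_not_empty)
  then obtain s b v where "kuhn_simplex p N b v s" and rl: "(reduced N \<circ> lab) ` s = {..N}"
    by (auto elim: ksimplex.cases)
  interpret kuhn_simplex p N b v s by fact
  \<comment> \<open>A Kuhn simplex has its coordinates from \<open>N\<close> on fixed at
    \<open>p\<close>, so its vertices lie in \<open>grid\<close> and are adjacent in all
    coordinates.\<close>
  have out: "x j = p" if "x \<in> s" "N \<le> j" for x j
    using that by (rule out_eq_p)
  have sg: "x \<in> grid" if "x \<in> s" for x
  proof -
    have "x j \<le> p" for j
      using s_space that out[OF that, of j] by (cases "j < N") (auto simp: Pi_iff)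
    then show ?thesis by (simp add: grid_def)
  qed
  have adj: "x j \<le> y j + 1" if "x \<in> s" "y \<in> s" for x y j
  proof (cases "j < N")
    case True
    have "x j \<le> Suc (b j)" "b j \<le> y j"
      using that True le_Suc_base base_le by auto
    then show ?thesis by simp
  qed (use that out[of x j] out[of y j] in simp)
  have "\<forall>t\<in>{..N}. \<exists>x\<in>s. reduced N (lab x) = t"
    using rl by (metis comp_apply imageE)
  then obtain f where f: "\<And>t. t \<le> N \<Longrightarrow> f t \<in> s \<and> reduced N (lab (f t)) = t"
    by (metis atMost_iff)
  \<comment> \<open>Adjacent vertices of one colour have the same \<open>u\<close> by
    \<open>near\<close>, hence the same label; so \<open>N + 1\<close> labels force
    \<open>N + 1\<close> colours.\<close>
  have "inj_on (c \<circ> f) {..N}"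
  proof (rule inj_onI)
    fix t t' assume t: "t \<in> {..N}" "t' \<in> {..N}" and eq: "(c \<circ> f) t = (c \<circ> f) t'"
    have "u (f t) = u (f t')"
      using f t eq sg adj by (intro near) auto
    from lab_cong[OF this] show "t = t'"
      using f t by (metis atMost_iff)
  qed
  moreover have "(c \<circ> f) ` {..N} \<subseteq> {..m}"
    using f sg col by auto
  ultimately have "card {..N} \<le> card {..m}"
    by (rule card_inj_on_le) simp
  then show ?thesis by simp
qed

lemma card_less_pairs:
  fixes A :: "'a :: linorder set"
  assumes "finite A"
  shows "card {(x, y) \<in> A \<times> A. x < y} = card A * (card A - 1) div 2"
proof -
  let ?L = "{(x, y) \<in> A \<times> A. x < y}" and ?G = "{(x, y) \<in> A \<times> A. y < x}"
  have fin: "finite ?L" "finite ?G"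
    using assms by (auto intro: finite_subset[of _ "A \<times> A"])
  have "A \<times> A = (?L \<union> ?G) \<union> Id_on A"
    by (auto simp: Id_on_def)
  then have "card (A \<times> A) = card ((?L \<union> ?G) \<union> Id_on A)"
    by (rule arg_cong)
  also have "\<dots> = card (?L \<union> ?G) + card (Id_on A)"
    using fin assms by (intro card_Un_disjoint) (auto simp: Id_on_def)
  also have "card (?L \<union> ?G) = card ?L + card ?G"
    using fin by (intro card_Un_disjoint) auto
  also have "card ?G = card ?L"
    by (rule bij_betw_same_card[of prod.swap]) (auto simp: bij_betw_def inj_on_def image_iff)
  also have "card (Id_on A) = card A"
    by (rule bij_betw_same_card[of fst]) (auto simp: bij_betw_def inj_on_def image_iff Id_on_def)
  finally have "card A * card A = 2 * card ?L + card A"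
    by (simp add: card_cartesian_product)
  then have "card A * (card A - 1) = 2 * card ?L"
    by (simp add: diff_mult_distrib2)
  then show ?thesis by simp
qed

section \<open>Isometry classes and their representatives\<close>

definition GH_class :: "nat \<Rightarrow> nat metric \<Rightarrow> nat metric set" where
  "GH_class n X = {Y \<in> metrics_upto n. isometric X Y}"

definition GH_rep :: "nat metric set \<Rightarrow> nat metric" where
  "GH_rep C = (SOME X. X \<in> C)"

lemma metrics_upto_finite: "X \<in> metrics_upto n \<Longrightarrow> X \<in> finite_metrics"
  by (simp add: metrics_upto_def finite_metrics_def)

lemma GH_upto_conv: "GH_upto n = GH_class n ` metrics_upto n"
  by (auto simp: GH_upto_def quotient_def GH_class_def)

lemma GH_rep_class:
  assumes "X \<in> metrics_upto n"
  shows "GH_rep (GH_class n X) \<in> GH_class n X"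
  unfolding GH_rep_def
  by (rule someI[of _ X]) (use assms isometric_refl in \<open>simp add: GH_class_def\<close>)

lemma GH_rep_mem:
  assumes "C \<in> GH_upto n"
  shows "GH_rep C \<in> metrics_upto n"
proof -
  obtain X where "X \<in> metrics_upto n" "C = GH_class n X"
    using assms by (auto simp: GH_upto_conv)
  then show ?thesis using GH_rep_class[of X n] by (simp add: GH_class_def)
qed

lemma GH_dist_conv: "GH_dist C D = gh (GH_rep C) (GH_rep D)"
  by (simp add: GH_dist_def gh_def GH_rep_def)

text \<open>Chosen representatives are at distance 0 from \<open>X\<close> and \<open>Y\<close>, so
  the triangle inequality in both directions removes the choice.\<close>

lemma GH_dist_class:
  assumes X: "X \<in> metrics_upto n" and Y: "Y \<in> metrics_upto n"
  shows "GH_dist (GH_class n X) (GH_class n Y) = gh X Y"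
proof -
  have *: "GH_rep (GH_class n Z) \<in> finite_metrics" "gh Z (GH_rep (GH_class n Z)) = 0"
    if "Z \<in> metrics_upto n" for Z
    using GH_rep_class[OF that] gh_isometric[OF metrics_upto_finite[OF that]]
    by (auto simp: GH_class_def metrics_upto_finite)
  let ?X = "GH_rep (GH_class n X)" and ?Y = "GH_rep (GH_class n Y)"
  have fin: "X \<in> finite_metrics" "Y \<in> finite_metrics" "?X \<in> finite_metrics" "?Y \<in> finite_metrics"
    using X Y * by (auto intro: metrics_upto_finite)
  have "gh ?X X = 0" "gh ?Y Y = 0" using *[OF X] *[OF Y] fin gh_commute by metis+
  then have "gh ?X ?Y = gh X Y"
    using *[OF X] *[OF Y] gh_triangle[of ?X X ?Y] gh_triangle[of X Y ?Y]
      gh_triangle[of X ?X Y] gh_triangle[of ?X ?Y Y] fin by linarith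
  then show ?thesis by (simp add: GH_dist_conv)
qed

text \<open>The distances of a metric coded by a grid point \<open>x\<close> lie in pairwise distant intervals of
  length \<open>p\<close>, one for each pair of points. Hence a correspondence of distortion below \<open>p\<close> has to
  preserve the index of a pair. All distances lie between \<open>K\<close> and \<open>2 * K\<close> for \<open>K = 3 * p * (N + 1)\<close>,
  which gives the triangle inequality.\<close>

locale grid_metrics =
  fixes n N p :: nat and e :: "nat \<times> nat \<Rightarrow> nat"
  assumes e: "bij_betw e {(i, j) \<in> {..<n} \<times> {..<n}. i < j} {..<N}" and p: "p > 0" and n: "n > 0"
begin

definition idx :: "nat \<Rightarrow> nat \<Rightarrow> nat" where
  "idx i j = e (min i j, max i j)"

definition gdist :: "(nat \<Rightarrow> nat) \<Rightarrow> nat \<Rightarrow> nat \<Rightarrow> real" where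
  "gdist x i j = (if i = j then 0 else real (3 * p * (N + 1) + 3 * p * idx i j + x (idx i j)))"

definition gmetric :: "(nat \<Rightarrow> nat) \<Rightarrow> nat metric" where
  "gmetric x = metric ({..<n}, gdist x)"

definition grid :: "(nat \<Rightarrow> nat) set" where
  "grid = {x. \<forall>j. x j \<le> p}"

lemma idx_less: "\<lbrakk>i < n; j < n; i \<noteq> j\<rbrakk> \<Longrightarrow> idx i j < N"
  using e unfolding idx_def bij_betw_def by (auto simp: min_def max_def image_subset_iff)

lemma gdist_bounds:
  assumes "x \<in> grid" "i < n" "j < n" "i \<noteq> j"
  shows "real (3 * p * (N + 1)) \<le> gdist x i j" "gdist x i j \<le> 2 * real (3 * p * (N + 1))"
proof -
  have "3 * p * idx i j \<le> 3 * p * N" using idx_less[OF assms(2-)] by (intro mult_le_mono2) simp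
  moreover have "x (idx i j) \<le> p" using assms(1) by (simp add: grid_def)
  ultimately have "3 * p * (N + 1) + 3 * p * idx i j + x (idx i j) \<le> 2 * (3 * p * (N + 1))"
    unfolding distrib_left mult_1_right by linarith
  then have "real (3 * p * (N + 1) + 3 * p * idx i j + x (idx i j)) \<le> real (2 * (3 * p * (N + 1)))"
    by (simp only: of_nat_le_iff)
  then show "gdist x i j \<le> 2 * real (3 * p * (N + 1))"
    using assms(4) by (simp add: gdist_def)
  show "real (3 * p * (N + 1)) \<le> gdist x i j"
    using assms(4) by (simp add: gdist_def)
qed

lemma Metric_space_gdist:
  assumes "x \<in> grid"
  shows "Metric_space {..<n} (gdist x)"
proof
  fix i j k
  show "0 \<le> gdist x i j" by (simp add: gdist_def)
  show "gdist x i j = gdist x j i" by (simp add: gdist_def idx_def min.commute max.commute)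
  show "gdist x i j = 0 \<longleftrightarrow> i = j"
    using p by (simp add: gdist_def del: of_nat_add of_nat_mult)
  show "gdist x i k \<le> gdist x i j + gdist x j k" if "i \<in> {..<n}" "j \<in> {..<n}" "k \<in> {..<n}"
  proof (cases "i = j \<or> j = k \<or> i = k")
    case True
    then show ?thesis by (auto simp: gdist_def)
  next
    case False
    then show ?thesis
      using gdist_bounds[OF assms, of i k] gdist_bounds[OF assms, of i j] gdist_bounds[OF assms, of j k] that
      by auto
  qed
qed

lemma gmetric_simps [simp]:
  assumes "x \<in> grid"
  shows "mspace (gmetric x) = {..<n}" "mdist (gmetric x) = gdist x"
proof -
  interpret Metric_space "{..<n}" "gdist x" by (rule Metric_space_gdist[OF assms])
  show "mspace (gmetric x) = {..<n}" "mdist (gmetric x) = gdist x"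
    by (simp_all add: gmetric_def)
qed

lemma gmetric_mem:
  assumes "x \<in> grid"
  shows "gmetric x \<in> metrics_upto n"
  using n by (simp add: metrics_upto_def assms lessThan_empty_iff)

text \<open>The identity correspondence suffices. The bound 1 is the disjointness scale of
  \<open>cover_lower_bound\<close>.\<close>

lemma gh_gmetric_adjacent:
  assumes x: "x \<in> grid" and y: "y \<in> grid" and adj: "\<And>j. x j \<le> y j + 1 \<and> y j \<le> x j + 1"
  shows "gh (gmetric x) (gmetric y) \<le> 1"
proof (rule gh_leI[OF metrics_upto_finite[OF gmetric_mem[OF x]]])
  show "correspondence (mspace (gmetric x)) (mspace (gmetric y)) (Id_on {..<n})"
    using x y by (auto simp: correspondence_def)
  have "\<bar>gdist x i j - gdist y i j\<bar> \<le> 2" for i j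
    using adj[of "idx i j"] by (simp add: gdist_def abs_le_iff)
  then show "distortion_le (gmetric x) (gmetric y) (Id_on {..<n}) (2 * 1)"
    using x y by (intro distortion_leI) auto
qed simp

lemma gh_gmetric_less:
  assumes x: "x \<in> grid" and y: "y \<in> grid" and gh: "gh (gmetric x) (gmetric y) < t"
    and t: "2 * t < real p" and j: "j < N"
  shows "\<bar>real (x j) - real (y j)\<bar> < real p"
proof -
  obtain R where R: "correspondence {..<n} {..<n} R" and dis: "distortion_le (gmetric x) (gmetric y) R (2 * t)"
    using gh_lessE[OF metrics_upto_finite[OF gmetric_mem[OF x]] metrics_upto_finite[OF gmetric_mem[OF y]] gh]
      x y by auto
  have "j \<in> e ` {(i, j) \<in> {..<n} \<times> {..<n}. i < j}" using e j by (simp add: bij_betw_def)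
  then obtain i k where ik: "i < k" "k < n" "e (i, k) = j" by auto
  then have idx: "idx i k = j" by (simp add: idx_def)
  obtain i' k' where R': "(i, i') \<in> R" "(k, k') \<in> R" "i' < n" "k' < n"
    using R ik unfolding correspondence_def by (metis less_trans lessThan_iff)
  have le: "\<bar>gdist x i k - gdist y i' k'\<bar> < real p"
    using distortion_leD[OF dis R'(1,2)] t x y by simp
  have ik_ge: "gdist x i k \<ge> real (3 * p * (N + 1))"
    using gdist_bounds[OF x, of i k] ik by auto
  \<comment> \<open>Related points cannot merge: a distance of at least
    \<open>3 * p * (N + 1)\<close> would differ from 0 by less than \<open>p\<close>.\<close>
  have ne: "i' \<noteq> k'"
  proof
    assume "i' = k'"
    then have "gdist y i' k' = 0" by (simp add: gdist_def)
    moreover have "real (3 * p * (N + 1)) \<ge> real p" by simp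
    ultimately show False using le ik_ge by linarith
  qed
  define j' where "j' = idx i' k'"
  have eq: "gdist x i k - gdist y i' k' = 3 * real p * (real j - real j') + (real (x j) - real (y j'))"
    using ne ik by (simp add: gdist_def idx j'_def algebra_simps)
  have xy: "x j \<le> p" "y j' \<le> p" using x y by (simp_all add: grid_def)
  \<comment> \<open>Different indices shift the distances by at least \<open>3 * p\<close>, and the
    grid coordinates compensate at most \<open>p\<close> of this.\<close>
  have "j = j'"
  proof (rule ccontr)
    assume "j \<noteq> j'"
    then have "real j - real j' \<ge> 1 \<or> real j' - real j \<ge> 1" by linarith
    then have "real p * (real j - real j') \<ge> real p \<or> real p * (real j' - real j) \<ge> real p"
      using mult_left_mono[of 1 "real j - real j'" "real p"] mult_left_mono[of 1 "real j' - real j" "real p"]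
      by auto
    then show False using le xy p unfolding eq by (auto simp: algebra_simps abs_less_iff)
  qed
  then show ?thesis using le unfolding eq by simp
qed

text \<open>A member of diameter at most \<open>r\<close> cannot meet opposite faces: a distance
  below \<open>r + 1\<close>, hence below half of \<open>p\<close>, keeps each coordinate difference
  below \<open>p\<close>.\<close>

lemma cover_lower_bound:
  assumes cover: "\<Union>(\<Union>i\<le>m. \<U> i) = GH_upto n"
    and disj: "\<forall>i\<le>m. r_disjoint GH_dist 1 (\<U> i)"
    and bdd: "\<And>U C D. \<lbrakk>U \<in> (\<Union>i\<le>m. \<U> i); C \<in> U; D \<in> U\<rbrakk> \<Longrightarrow> GH_dist C D \<le> r"
    and r: "2 * (r + 1) < real p"
  shows "N \<le> m"
proof -
  define F where "F x = GH_class n (gmetric x)" for x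
  have "\<exists>i U. i \<le> m \<and> U \<in> \<U> i \<and> F x \<in> U" if "x \<in> grid" for x
  proof -
    have "F x \<in> \<Union>(\<Union>i\<le>m. \<U> i)"
      unfolding cover F_def GH_upto_conv using gmetric_mem[OF that] by blast
    then show ?thesis by blast
  qed
  then obtain c u where cu: "\<And>x. x \<in> grid \<Longrightarrow> c x \<le> m \<and> u x \<in> \<U> (c x) \<and> F x \<in> u x"
    by metis
  have dist: "GH_dist (F x) (F y) = gh (gmetric x) (gmetric y)" if "x \<in> grid" "y \<in> grid" for x y
    unfolding F_def using that by (intro GH_dist_class gmetric_mem)
  show ?thesis
  proof (rule grid_covering_dimension[OF p, of c m u]; fold grid_def)
    fix x assume "x \<in> grid"
    then show "c x \<le> m" using cu by blast
  next
    fix x y assume x: "x \<in> grid" and y: "y \<in> grid" and eq: "c x = c y"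
      and adj: "\<And>j. x j \<le> y j + 1 \<and> y j \<le> x j + 1"
    show "u x = u y"
    proof (rule ccontr)
      assume "u x \<noteq> u y"
      then have "ennreal 1 < (INF (a, b)\<in>u x \<times> u y. ennreal (GH_dist a b))"
        using disj cu[OF x] cu[OF y] eq unfolding r_disjoint_def by metis
      also have "\<dots> \<le> ennreal (GH_dist (F x) (F y))"
        using cu[OF x] cu[OF y] by (intro INF_lower2[of "(F x, F y)"]) auto
      also have "\<dots> \<le> ennreal 1"
        unfolding dist[OF x y] by (intro ennreal_leI gh_gmetric_adjacent x y adj)
      finally show False by simp
    qed
  next
    fix x y j assume x: "x \<in> grid" and y: "y \<in> grid" and eq: "u x = u y" and j: "j < N" and xj: "x j = 0"
    have "u x \<in> (\<Union>i\<le>m. \<U> i)" "F x \<in> u x" "F y \<in> u x" using cu[OF x] cu[OF y] eq by auto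
    then have "gh (gmetric x) (gmetric y) < r + 1"
      using bdd[of "u x" "F x" "F y"] dist[OF x y] by simp
    from gh_gmetric_less[OF x y this r j] show "y j \<noteq> p" using xj by auto
  qed
qed

end

text \<open>The cover is taken at scale 1; its diameter bound \<open>r\<close> then determines how
  large a grid to embed.\<close>

theorem asdim_le_GH_upto_lower:
  assumes dim: "asdim_le (GH_upto n) GH_dist m"
  shows "n * (n - 1) div 2 \<le> m"
proof (cases "n = 0")
  case False
  let ?P = "{(i, j) \<in> {..<n} \<times> {..<n}. i < j}"
  have "finite ?P" by (rule finite_subset[of _ "{..<n} \<times> {..<n}"]) auto
  then obtain e where "bij_betw e ?P {0..<card ?P}" using ex_bij_betw_finite_nat by blast
  then have e: "bij_betw e ?P {..<n * (n - 1) div 2}"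
    using card_less_pairs[of "{..<n}"] by (simp add: lessThan_atLeast0)
  obtain \<U> where cover: "\<Union>(\<Union>i\<le>m. \<U> i) = GH_upto n"
    and ub: "uniformly_bounded GH_dist (\<Union>i\<le>m. \<U> i)"
    and disj: "\<forall>i\<le>m. r_disjoint GH_dist 1 (\<U> i)"
    using dim zero_less_one unfolding asdim_le_def by metis
  obtain r where r: "\<forall>U\<in>(\<Union>i\<le>m. \<U> i). \<forall>x\<in>U. \<forall>y\<in>U. GH_dist x y \<le> r" and r0: "r \<ge> 0"
    using ub unfolding uniformly_bounded_def by blast
  define p where "p = nat \<lceil>2 * (r + 1)\<rceil> + 1"
  have p_large: "2 * (r + 1) < real p" unfolding p_def using r0 by linarith
  have "p > 0" by (simp add: p_def)
  interpret grid_metrics n "n * (n - 1) div 2" p e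
    by standard (use e \<open>p > 0\<close> False in auto)
  have "GH_dist C D \<le> r" if "U \<in> (\<Union>i\<le>m. \<U> i)" "C \<in> U" "D \<in> U" for U C D
    using r that by blast
  from cover_lower_bound[OF cover disj this p_large] show ?thesis .
qed simp

section \<open>Upper bound\<close>

definition near_multiple :: "real \<Rightarrow> real \<Rightarrow> real \<Rightarrow> bool" where
  "near_multiple L t u \<longleftrightarrow> (\<exists>z::int. \<bar>u - of_int z * L\<bar> \<le> t)"

text \<open>Names the face of the decomposition in one coordinate: the vertex \<open>z * L\<close>
  if \<open>u\<close> is near one, otherwise the edge containing \<open>u\<close>. The vertex is
  unique if \<open>2 * t < L\<close>.\<close>

definition cell :: "real \<Rightarrow> real \<Rightarrow> real \<Rightarrow> bool \<times> int" where
  "cell L t u = (if near_multiple L t u then (True, SOME z. \<bar>u - of_int z * L\<bar> \<le> t)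
     else (False, \<lfloor>u / L\<rfloor>))"

lemma cell_near:
  assumes "near_multiple L t u"
  obtains z where "cell L t u = (True, z)" "\<bar>u - of_int z * L\<bar> \<le> t"
  using assms someI_ex[of "\<lambda>z::int. \<bar>u - of_int z * L\<bar> \<le> t"]
  unfolding near_multiple_def cell_def by auto

lemma cell_far: "\<not> near_multiple L t u \<Longrightarrow> cell L t u = (False, \<lfloor>u / L\<rfloor>)"
  by (simp add: cell_def)

lemma near_multiple_shift:
  assumes "near_multiple L t u" "\<bar>u - v\<bar> \<le> \<rho>"
  shows "near_multiple L (t + \<rho>) v"
proof -
  obtain z :: int where "\<bar>u - of_int z * L\<bar> \<le> t" using assms by (auto simp: near_multiple_def)
  then have "\<bar>v - of_int z * L\<bar> \<le> t + \<rho>" using assms(2) by linarith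
  then show ?thesis by (auto simp: near_multiple_def)
qed

text \<open>Otherwise a multiple of \<open>L\<close> would lie between \<open>u\<close> and
  \<open>v\<close>, hence within \<open>t\<close> of \<open>u\<close>.\<close>

lemma floor_le_of_far:
  assumes far: "\<not> near_multiple L t u" and L: "L > 0" and uv: "\<bar>u - v\<bar> \<le> t"
  shows "\<lfloor>v / L\<rfloor> \<le> \<lfloor>u / L\<rfloor>"
proof (rule ccontr)
  assume "\<not> \<lfloor>v / L\<rfloor> \<le> \<lfloor>u / L\<rfloor>"
  then have "u / L < of_int \<lfloor>v / L\<rfloor>" by linarith
  moreover have "of_int \<lfloor>v / L\<rfloor> \<le> v / L" by simp
  ultimately have "u < of_int \<lfloor>v / L\<rfloor> * L" "of_int \<lfloor>v / L\<rfloor> * L \<le> v"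
    by (simp_all only: pos_divide_less_eq[OF L] pos_le_divide_eq[OF L])
  then have "\<bar>u - of_int \<lfloor>v / L\<rfloor> * L\<bar> \<le> t" using uv by linarith
  then show False using far by (auto simp: near_multiple_def)
qed

text \<open>The last two hypotheses exclude the shell between \<open>t\<close> and
  \<open>t + \<rho>\<close> around the multiples of \<open>L\<close>, which a step of length
  \<open>\<rho>\<close> cannot jump. In the near case \<open>2 * t + \<rho> < L\<close> leaves one
  multiple for both; in the far case no multiple separates the two.\<close>

lemma cell_eq:
  assumes \<rho>: "\<rho> \<le> t" and L: "2 * t + \<rho> < L" "0 \<le> \<rho>" and uv: "\<bar>u - v\<bar> \<le> \<rho>"
    and u: "near_multiple L t u \<or> \<not> near_multiple L (t + \<rho>) u"
    and v: "near_multiple L t v \<or> \<not> near_multiple L (t + \<rho>) v"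
  shows "cell L t u = cell L t v"
proof (cases "near_multiple L t u")
  case True
  then have "near_multiple L t v"
    using near_multiple_shift[OF True uv] v by blast
  then obtain z' where z': "cell L t v = (True, z')" "\<bar>v - of_int z' * L\<bar> \<le> t"
    by (rule cell_near)
  obtain z where z: "cell L t u = (True, z)" "\<bar>u - of_int z * L\<bar> \<le> t"
    using True by (rule cell_near)
  have "\<bar>of_int z * L - of_int z' * L\<bar> < L"
    using z(2) z'(2) uv L by linarith
  then have "\<bar>of_int (z - z') * L\<bar> < 1 * L" by (simp add: algebra_simps)
  moreover have "L > 0" using L \<rho> by linarith
  ultimately have "\<bar>of_int (z - z')\<bar> < (1::real)"
    by (simp add: abs_mult)
  then have "z = z'" by linarith
  then show ?thesis using z z' by simp
next
  case False
  have vu: "\<bar>v - u\<bar> \<le> \<rho>" using uv by (simp add: abs_minus_commute)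
  have False': "\<not> near_multiple L t v"
    using near_multiple_shift[OF _ vu] u False by blast
  have "L > 0" using L \<rho> by linarith
  then have "\<lfloor>u / L\<rfloor> = \<lfloor>v / L\<rfloor>"
    using floor_le_of_far[OF False _ order_trans[OF uv \<rho>]] floor_le_of_far[OF False' _ order_trans[OF vu \<rho>]]
    by simp
  then show ?thesis by (simp add: cell_far False False')
qed

lemma cell_bound:
  assumes eq: "cell L t u = cell L t v" and L: "2 * t \<le> L" "L > 0"
  shows "\<bar>u - v\<bar> \<le> L"
proof (cases "near_multiple L t u")
  case True
  then obtain z where z: "cell L t u = (True, z)" "\<bar>u - of_int z * L\<bar> \<le> t"
    by (rule cell_near)
  then have "near_multiple L t v" using eq cell_far[of L t v] by auto
  then obtain z' where "cell L t v = (True, z')" "\<bar>v - of_int z' * L\<bar> \<le> t"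
    by (rule cell_near)
  then show ?thesis using z eq L by (simp add: abs_le_iff)
next
  case False
  then have "\<not> near_multiple L t v" using eq cell_near[of L t v] cell_far[of L t u] by force
  then have "\<lfloor>u / L\<rfloor> = \<lfloor>v / L\<rfloor>" using eq False by (simp add: cell_far)
  then have "\<bar>u / L - v / L\<bar> \<le> 1" by linarith
  then show ?thesis using L by (simp add: diff_divide_distrib[symmetric])
qed

text \<open>The metrics with \<open>n\<close> points and distances above \<open>\<rho>\<close>. A correspondence of distortion at most
  \<open>\<rho>\<close> between two of them is a bijection.\<close>

definition separated_metrics :: "nat \<Rightarrow> real \<Rightarrow> nat metric set" where
  "separated_metrics n \<rho> = {X \<in> metrics_upto n. card (mspace X) = n \<and>
     (\<forall>x\<in>mspace X. \<forall>y\<in>mspace X. x \<noteq> y \<longrightarrow> \<rho> < mdist X x y)}"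

lemma separated_metrics_finite: "X \<in> separated_metrics n \<rho> \<Longrightarrow> X \<in> finite_metrics"
  by (auto simp: separated_metrics_def intro: metrics_upto_finite)

lemma separated_metrics_eq:
  "\<lbrakk>X \<in> separated_metrics n \<rho>; x \<in> mspace X; y \<in> mspace X; mdist X x y \<le> \<rho>\<rbrakk> \<Longrightarrow> x = y"
  unfolding separated_metrics_def by force

text \<open>Two points related to a common one would be at distance at most \<open>\<rho>\<close>,
  against the separation.\<close>

lemma separated_metrics_bij:
  assumes X: "X \<in> separated_metrics n \<rho>" and Y: "Y \<in> separated_metrics n \<rho>"
    and gh: "2 * gh X Y < \<rho>"
  obtains f where "bij_betw f (mspace X) (mspace Y)"
    "\<And>x y. \<lbrakk>x \<in> mspace X; y \<in> mspace X\<rbrakk> \<Longrightarrow> \<bar>mdist X x y - mdist Y (f x) (f y)\<bar> \<le> \<rho>"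
proof -
  have "gh X Y < \<rho> / 2" using gh by simp
  then obtain R where R: "correspondence (mspace X) (mspace Y) R"
    and "distortion_le X Y R (2 * (\<rho> / 2))"
    using gh_lessE[OF separated_metrics_finite[OF X] separated_metrics_finite[OF Y]] by blast
  then have dis: "distortion_le X Y R \<rho>" by simp
  have mem: "x \<in> mspace X" "y \<in> mspace Y" if "(x, y) \<in> R" for x y
    using R that by (auto simp: correspondence_def)
  have right_unique: "y = y'" if "(x, y) \<in> R" "(x, y') \<in> R" for x y y'
  proof (rule separated_metrics_eq[OF Y])
    have "mdist X x x = 0" using mem[OF that(1)] by simp
    then show "mdist Y y y' \<le> \<rho>" using distortion_leD[OF dis that] by simp
  qed (use mem that in auto)
  have left_unique: "x = x'" if "(x, y) \<in> R" "(x', y) \<in> R" for x x' y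
  proof (rule separated_metrics_eq[OF X])
    have "mdist Y y y = 0" using mem[OF that(1)] by simp
    then show "mdist X x x' \<le> \<rho>" using distortion_leD[OF dis that] by simp
  qed (use mem that in auto)
  have "\<forall>x\<in>mspace X. \<exists>y. (x, y) \<in> R" using R by (auto simp: correspondence_def)
  then obtain f where f: "\<And>x. x \<in> mspace X \<Longrightarrow> (x, f x) \<in> R" by metis
  show thesis
  proof (rule that)
    show "bij_betw f (mspace X) (mspace Y)"
      unfolding bij_betw_def
    proof (intro conjI equalityI subsetI)
      show "inj_on f (mspace X)"
      proof (rule inj_onI)
        fix x y assume "x \<in> mspace X" "y \<in> mspace X" "f x = f y"
        then show "x = y" using f[of x] f[of y] left_unique by simp
      qed
      show "y \<in> mspace Y" if "y \<in> f ` mspace X" for y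
        using that mem(2)[OF f] by blast
      show "y \<in> f ` mspace X" if "y \<in> mspace Y" for y
      proof -
        obtain x where "x \<in> mspace X" "(x, y) \<in> R" using R \<open>y \<in> mspace Y\<close> by (auto simp: correspondence_def)
        then show ?thesis using right_unique[OF f] by blast
      qed
    qed
    show "\<bar>mdist X x y - mdist Y (f x) (f y)\<bar> \<le> \<rho>" if "x \<in> mspace X" "y \<in> mspace X" for x y
      using distortion_leD[OF dis f[OF that(1)] f[OF that(2)]] .
  qed
qed

text \<open>A point of \<open>\<real>\<^sup>N\<close> has colour \<open>k\<close> if it is close to the \<open>k\<close>-skeleton, but not to the
  \<open>(k - 1)\<close>-skeleton, of the cubical decomposition with side length \<open>L\<close>. The thresholds \<open>thr k\<close>
  decrease with \<open>k\<close>, so that points of the same colour near distinct \<open>k\<close>-cubes are far apart. The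
  colour depends only on the number of coordinates far from the multiples of \<open>L\<close>; hence it is
  invariant under permutations and defined for metrics.\<close>

locale cubical_colouring =
  fixes n :: nat and \<rho> :: real
  assumes \<rho>: "\<rho> > 0"
begin

definition N :: nat where "N = n * (n - 1) div 2"
text \<open>The thresholds fall from \<open>(N + 1) * \<rho>\<close> at \<open>k = 0\<close> to
  \<open>\<rho>\<close> at \<open>k = N\<close>; \<open>L\<close> is chosen to exceed
  \<open>2 * thr 0 + \<rho>\<close>, as \<open>cell_eq\<close> demands.\<close>

definition L :: real where "L = (2 * real N + 4) * \<rho>"
definition thr :: "nat \<Rightarrow> real" where "thr k = (real N + 1 - real k) * \<rho>"

definition far_pairs :: "real \<Rightarrow> nat metric \<Rightarrow> (nat \<times> nat) set" where
  "far_pairs t X = {(x, y) \<in> mspace X \<times> mspace X. x < y \<and> \<not> near_multiple L t (mdist X x y)}"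

definition colour :: "nat metric \<Rightarrow> nat" where
  "colour X = (LEAST k. card (far_pairs (thr k) X) \<le> k)"

lemma L_pos: "L > 0" using \<rho> by (simp add: L_def add_pos_pos)

lemma thr_bounds:
  assumes "k \<le> N"
  shows "\<rho> \<le> thr k" "2 * thr k + \<rho> < L"
proof -
  have "1 * \<rho> \<le> (real N + 1 - real k) * \<rho>"
    using assms \<rho> by (intro mult_right_mono) auto
  then show "\<rho> \<le> thr k" by (simp add: thr_def)
  have "L - (2 * thr k + \<rho>) = (1 + 2 * real k) * \<rho>"
    by (simp add: thr_def L_def algebra_simps)
  moreover have "(1 + 2 * real k) * \<rho> > 0" using \<rho> by (intro mult_pos_pos) auto
  ultimately show "2 * thr k + \<rho> < L" by linarith
qed

lemma thr_Suc: "thr k = thr (Suc k) + \<rho>"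
  by (simp add: thr_def algebra_simps)

lemma finite_far_pairs:
  "X \<in> finite_metrics \<Longrightarrow> finite (far_pairs t X)"
  by (rule finite_subset[of _ "mspace X \<times> mspace X"]) (auto simp: far_pairs_def finite_metrics_def)

lemma card_far_pairs:
  assumes "X \<in> separated_metrics n \<sigma>"
  shows "card (far_pairs t X) \<le> N"
proof -
  have fin: "finite (mspace X)" "card (mspace X) = n"
    using assms by (auto simp: separated_metrics_def metrics_upto_def)
  have "finite {(x, y) \<in> mspace X \<times> mspace X. x < y}"
    by (rule finite_subset[of _ "mspace X \<times> mspace X"]) (use fin in auto)
  then have "card (far_pairs t X) \<le> card {(x, y) \<in> mspace X \<times> mspace X. x < y}"
    by (rule card_mono) (auto simp: far_pairs_def)
  then show ?thesis using card_less_pairs[OF fin(1)] fin(2) by (simp add: N_def)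
qed

text \<open>The least number exists and is at most \<open>N\<close>, because there are only
  \<open>N\<close> pairs.\<close>

lemma card_far_pairs_colour:
  assumes "X \<in> separated_metrics n \<sigma>"
  shows "card (far_pairs (thr (colour X)) X) \<le> colour X" "colour X \<le> N"
  unfolding colour_def
  by (rule LeastI, rule card_far_pairs[OF assms]) (rule Least_le, rule card_far_pairs[OF assms])

text \<open>For colour \<open>k = j + 1\<close>, minimality makes more than \<open>j\<close> pairs
  far at \<open>thr j = thr k + \<rho>\<close>, while at most \<open>k\<close> are far at
  \<open>thr k\<close>. The first set is contained in the second, so they agree and no pair lies in
  the shell. For colour 0 no pair is far.\<close>

lemma colour_gap:
  assumes X: "X \<in> separated_metrics n \<sigma>" and x: "x \<in> mspace X" and y: "y \<in> mspace X"
  shows "near_multiple L (thr (colour X)) (mdist X x y) \<or>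
    \<not> near_multiple L (thr (colour X) + \<rho>) (mdist X x y)"
proof -
  let ?k = "colour X"
  have less: "near_multiple L (thr ?k) (mdist X a b) \<or> \<not> near_multiple L (thr ?k + \<rho>) (mdist X a b)"
    if "a \<in> mspace X" "b \<in> mspace X" "a < b" for a b
  proof (cases ?k)
    case 0
    then have "far_pairs (thr ?k) X = {}"
      using card_far_pairs_colour(1)[OF X] finite_far_pairs[OF separated_metrics_finite[OF X]] by simp
    then show ?thesis using that by (auto simp: far_pairs_def)
  next
    case (Suc j)
    have thr: "thr ?k + \<rho> = thr j" unfolding Suc thr_Suc[of j] ..
    have "\<not> card (far_pairs (thr j) X) \<le> j"
      using not_less_Least[of j "\<lambda>k. card (far_pairs (thr k) X) \<le> k"] Suc
      unfolding colour_def by simp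
    then have "card (far_pairs (thr ?k) X) \<le> card (far_pairs (thr j) X)"
      using card_far_pairs_colour(1)[OF X] Suc by linarith
    moreover have "far_pairs (thr j) X \<subseteq> far_pairs (thr ?k) X"
    proof -
      have "near_multiple L (thr j) u" if "near_multiple L (thr ?k) u" for u
        using near_multiple_shift[OF that, of u \<rho>] \<rho> thr by simp
      then show ?thesis by (auto simp: far_pairs_def)
    qed
    ultimately have "far_pairs (thr j) X = far_pairs (thr ?k) X"
      using finite_far_pairs[OF separated_metrics_finite[OF X]] by (intro card_seteq)
    then have "(a, b) \<in> far_pairs (thr j) X \<longleftrightarrow> (a, b) \<in> far_pairs (thr ?k) X" by simp
    then show ?thesis using that thr by (auto simp: far_pairs_def)
  qed
  consider "x < y" | "y < x" | "x = y" by linarith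
  then show ?thesis
  proof cases
    case 1
    then show ?thesis using less x y by blast
  next
    case 2
    then show ?thesis using less[OF y x] by (simp add: mdist_commute)
  next
    case 3
    then have "mdist X x y = 0" using x by simp
    moreover have "0 \<le> thr ?k" using thr_bounds(1)[OF card_far_pairs_colour(2)[OF X]] \<rho> by linarith
    ultimately show ?thesis by (auto simp: near_multiple_def intro!: exI[of _ 0])
  qed
qed

text \<open>By \<open>colour_gap\<close> at both ends of a step, the bijection of that step
  preserves cells; so does their composition, however long the chain is.\<close>

lemma chain_lift:
  assumes r: "2 * r < \<rho>"
    and chain: "(X, Y) \<in> (chain_step (separated_metrics n \<rho>) gh colour r)\<^sup>*"
    and X: "X \<in> separated_metrics n \<rho>"
  shows "\<exists>f. bij_betw f (mspace X) (mspace Y) \<and>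
    (\<forall>x\<in>mspace X. \<forall>y\<in>mspace X.
       cell L (thr (colour X)) (mdist X x y) = cell L (thr (colour X)) (mdist Y (f x) (f y)))"
  using chain
proof (induction rule: rtrancl_induct)
  case base
  show ?case by (rule exI[of _ "\<lambda>x. x"]) (simp add: bij_betw_def)
next
  case (step Y Z)
  obtain f where f: "bij_betw f (mspace X) (mspace Y)"
    and f_cell: "\<And>x y. \<lbrakk>x \<in> mspace X; y \<in> mspace X\<rbrakk> \<Longrightarrow>
       cell L (thr (colour X)) (mdist X x y) = cell L (thr (colour X)) (mdist Y (f x) (f y))"
    using step.IH by blast
  have Y: "Y \<in> separated_metrics n \<rho>" and Z: "Z \<in> separated_metrics n \<rho>"
    and YZ: "colour Z = colour Y" "gh Y Z \<le> r"
    using step.hyps(2) by (auto simp: chain_step_def)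
  have XY: "colour Y = colour X" using chain_step_mem[OF step.hyps(1) X] by simp
  obtain g where g: "bij_betw g (mspace Y) (mspace Z)"
    and g_dist: "\<And>x y. \<lbrakk>x \<in> mspace Y; y \<in> mspace Y\<rbrakk> \<Longrightarrow> \<bar>mdist Y x y - mdist Z (g x) (g y)\<bar> \<le> \<rho>"
    using separated_metrics_bij[OF Y Z] YZ r by (metis le_less_trans mult_left_mono zero_le_numeral)
  have thr: "\<rho> \<le> thr (colour X)" "2 * thr (colour X) + \<rho> < L"
    using thr_bounds[OF card_far_pairs_colour(2)[OF X]] by auto
  have g_cell: "cell L (thr (colour X)) (mdist Y x y) = cell L (thr (colour X)) (mdist Z (g x) (g y))"
    if "x \<in> mspace Y" "y \<in> mspace Y" for x y
  proof (rule cell_eq[OF thr less_imp_le[OF \<rho>] g_dist[OF that]])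
    show "near_multiple L (thr (colour X)) (mdist Y x y) \<or>
        \<not> near_multiple L (thr (colour X) + \<rho>) (mdist Y x y)"
      using colour_gap[OF Y that] XY by simp
    have "g x \<in> mspace Z" "g y \<in> mspace Z" using g that by (auto simp: bij_betw_def)
    then show "near_multiple L (thr (colour X)) (mdist Z (g x) (g y)) \<or>
        \<not> near_multiple L (thr (colour X) + \<rho>) (mdist Z (g x) (g y))"
      using colour_gap[OF Z] XY YZ by simp
  qed
  have f_mem: "f x \<in> mspace Y" if "x \<in> mspace X" for x using f that by (auto simp: bij_betw_def)
  show ?case
  proof (intro exI[of _ "g \<circ> f"] conjI ballI)
    show "bij_betw (g \<circ> f) (mspace X) (mspace Z)" using f g by (rule bij_betw_trans)
    fix x y assume "x \<in> mspace X" "y \<in> mspace X"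
    then show "cell L (thr (colour X)) (mdist X x y) =
        cell L (thr (colour X)) (mdist Z ((g \<circ> f) x) ((g \<circ> f) y))"
      using f_cell g_cell[OF f_mem f_mem] by simp
  qed
qed

lemma chain_colouring_separated:
  assumes r: "2 * r < \<rho>"
  shows "chain_colouring (separated_metrics n \<rho>) gh N r colour L"
  unfolding chain_colouring_def
proof (intro conjI ballI allI impI)
  fix X assume X: "X \<in> separated_metrics n \<rho>"
  show "colour X \<le> N" by (rule card_far_pairs_colour(2)[OF X])
  fix Y assume "(X, Y) \<in> (chain_step (separated_metrics n \<rho>) gh colour r)\<^sup>*"
  from chain_lift[OF r this X] obtain f where f: "bij_betw f (mspace X) (mspace Y)"
    and f_cell: "\<And>x y. \<lbrakk>x \<in> mspace X; y \<in> mspace X\<rbrakk> \<Longrightarrow>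
       cell L (thr (colour X)) (mdist X x y) = cell L (thr (colour X)) (mdist Y (f x) (f y))"
    by blast
  have thr: "2 * thr (colour X) \<le> L"
    using thr_bounds(2)[OF card_far_pairs_colour(2)[OF X]] \<rho> by linarith
  show "gh X Y \<le> L"
  proof (rule gh_leI[OF separated_metrics_finite[OF X]])
    show "correspondence (mspace X) (mspace Y) {(x, f x) | x. x \<in> mspace X}"
      using f by (auto simp: correspondence_def bij_betw_def)
    show "distortion_le X Y {(x, f x) | x. x \<in> mspace X} (2 * L)"
    proof (rule distortion_leI)
      fix x y x' y' assume "(x, y) \<in> {(x, f x) | x. x \<in> mspace X}" "(x', y') \<in> {(x, f x) | x. x \<in> mspace X}"
      then have "x \<in> mspace X" "x' \<in> mspace X" "y = f x" "y' = f x'" by auto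
      then have "\<bar>mdist X x x' - mdist Y y y'\<bar> \<le> L"
        using cell_bound[OF f_cell thr L_pos] by simp
      then show "\<bar>mdist X x x' - mdist Y y y'\<bar> \<le> 2 * L" using L_pos by linarith
    qed
  qed (use L_pos in simp)
qed

end

section \<open>Metrics with close points and the induction on the number of points\<close>

lemma pseudometric_finite_metrics: "pseudometric finite_metrics gh"
  by standard (auto simp: gh_nonneg gh_self gh_commute intro: gh_triangle)

text \<open>With full cardinality, \<open>X\<close> has two points within \<open>\<rho>\<close>; one
  is deleted and related to the other.\<close>

lemma remove_close_point:
  assumes X: "X \<in> metrics_upto (Suc n)" "X \<notin> separated_metrics (Suc n) \<rho>" and \<rho>: "\<rho> \<ge> 0"
  shows "\<exists>Y\<in>metrics_upto n. gh X Y \<le> \<rho>"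
proof (cases "card (mspace X) = Suc n")
  case False
  then have "X \<in> metrics_upto n" using X by (auto simp: metrics_upto_def)
  then show ?thesis using gh_self[OF metrics_upto_finite] \<rho> by (intro bexI[of _ X]) auto
next
  case True
  then obtain x y where xy: "x \<in> mspace X" "y \<in> mspace X" "x \<noteq> y" "mdist X x y \<le> \<rho>"
    using X by (force simp: separated_metrics_def)
  let ?Y = "submetric X (- {x})" and ?R = "insert (x, y) (Id_on (mspace X - {x}))"
  have sp: "mspace ?Y = mspace X - {x}" by auto
  have "?Y \<in> metrics_upto n"
    using X xy True unfolding metrics_upto_def mem_Collect_eq sp by auto
  moreover have "gh X ?Y \<le> \<rho>"
  proof (rule gh_leI[OF metrics_upto_finite[OF X(1)]])
    show "correspondence (mspace X) (mspace ?Y) ?R"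
      using xy unfolding sp by (auto simp: correspondence_def)
    have *: "\<bar>mdist X x z - mdist X y z\<bar> \<le> \<rho>" if "z \<in> mspace X" for z
      using mdist_triangle[of x X y z] mdist_triangle[of y X x z] mdist_commute[of X x y] xy that
      by (simp add: abs_le_iff)
    have **: "mdist X x x = 0" "mdist X y y = 0" using xy by simp_all
    show "distortion_le X ?Y ?R (2 * \<rho>)"
    proof (rule distortion_leI)
      fix a b a' b' assume "(a, b) \<in> ?R" "(a', b') \<in> ?R"
      then consider "a = x" "b = y" "a' = x" "b' = y" | "a = x" "b = y" "a' = b'" "a' \<in> mspace X"
        | "a = b" "a \<in> mspace X" "a' = x" "b' = y" | "a = b" "a' = b'" by auto
      then show "\<bar>mdist X a a' - mdist ?Y b b'\<bar> \<le> 2 * \<rho>"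
      proof cases
        case 1
        then show ?thesis using ** \<rho> by simp
      next
        case 2
        then show ?thesis using *[of a'] \<rho> by simp
      next
        case 3
        then show ?thesis using *[of a] \<rho> by (simp add: mdist_commute)
      next
        case 4
        then show ?thesis using \<rho> by simp
      qed
    qed
  qed fact
  ultimately show ?thesis by blast
qed

lemma coarse_dim_le_near:
  assumes dim: "coarse_dim_le (metrics_upto n) gh m" and A: "A \<subseteq> finite_metrics" and \<rho>: "\<rho> \<ge> 0"
    and near: "\<And>X. X \<in> A \<Longrightarrow> \<exists>Y\<in>metrics_upto n. gh X Y \<le> \<rho>"
  shows "coarse_dim_le A gh m"
proof -
  obtain \<pi> where \<pi>: "\<And>X. X \<in> A \<Longrightarrow> \<pi> X \<in> metrics_upto n \<and> gh X (\<pi> X) \<le> \<rho>"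
    using near by metis
  have fin: "X \<in> finite_metrics" "\<pi> X \<in> finite_metrics" "gh (\<pi> X) X \<le> \<rho>" if "X \<in> A" for X
  proof -
    show fin: "X \<in> finite_metrics" "\<pi> X \<in> finite_metrics"
      using that A \<pi>[OF that] by (auto intro: metrics_upto_finite)
    show "gh (\<pi> X) X \<le> \<rho>"
      using \<pi>[OF that] unfolding gh_commute[OF fin(2,1)] by blast
  qed
  show ?thesis
  proof (rule coarse_dim_le_pullback[OF dim, of \<pi> A "2 * \<rho>"])
    show "\<pi> ` A \<subseteq> metrics_upto n" using \<pi> by blast
    show "0 \<le> 2 * \<rho>" using \<rho> by simp
    fix X Y assume X: "X \<in> A" and Y: "Y \<in> A"
    show "gh (\<pi> X) (\<pi> Y) \<le> gh X Y + 2 * \<rho>"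
      using gh_triangle[of "\<pi> X" X "\<pi> Y"] gh_triangle[of X Y "\<pi> Y"] fin[OF X] fin[OF Y] \<pi>[OF Y] by simp
    show "gh X Y \<le> gh (\<pi> X) (\<pi> Y) + 2 * \<rho>"
      using gh_triangle[of X "\<pi> X" Y] gh_triangle[of "\<pi> X" "\<pi> Y" Y] fin[OF X] fin[OF Y] \<pi>[OF X] by simp
  qed
qed

theorem coarse_dim_le_metrics_upto:
  "coarse_dim_le (metrics_upto n) gh (n * (n - 1) div 2)"
proof (induction n)
  case 0
  have "metrics_upto 0 = {}" by (auto simp: metrics_upto_def)
  then show ?case by (simp add: coarse_dim_le_empty)
next
  case (Suc n)
  let ?N = "Suc n * (Suc n - 1) div 2"
  have "n * (n - 1) \<le> Suc n * (Suc n - 1)" by (intro mult_le_mono) auto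
  then have IH: "coarse_dim_le (metrics_upto n) gh ?N"
    using coarse_dim_le_mono[OF Suc.IH] div_le_mono by blast
  show ?case
    unfolding coarse_dim_le_def
  proof (intro allI impI)
    fix r :: real assume r: "r > 0"
    \<comment> \<open>Any value above \<open>2 * r\<close> lets steps of length \<open>r\<close>
      lift to bijections.\<close>
    define \<rho> where "\<rho> = 2 * r + 1"
    interpret C: cubical_colouring "Suc n" \<rho> by standard (use r in \<open>simp add: \<rho>_def\<close>)
    let ?C = "separated_metrics (Suc n) \<rho>"
    define A where "A = metrics_upto (Suc n) - ?C"
    have colC: "chain_colouring ?C gh ?N r C.colour C.L"
      using C.chain_colouring_separated[of r] by (simp add: \<rho>_def C.N_def)
    have "coarse_dim_le A gh ?N"
    proof (rule coarse_dim_le_near[OF IH])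
      show "A \<subseteq> finite_metrics" by (auto simp: A_def intro: metrics_upto_finite)
      show "0 \<le> \<rho>" using C.\<rho> by simp
      then show "\<exists>Y\<in>metrics_upto n. gh X Y \<le> \<rho>" if "X \<in> A" for X
        using that by (intro remove_close_point) (auto simp: A_def)
    qed
    \<comment> \<open>The scale at which \<open>chain_colouring_Un\<close> needs \<open>A\<close>
      coloured, given the bound \<open>C.L\<close> on the separated metrics.\<close>
    moreover have "C.L + 2 * r > 0" using C.L_pos r by simp
    ultimately obtain c B where colA: "chain_colouring A gh ?N (C.L + 2 * r) c B"
      unfolding coarse_dim_le_def by blast
    have "A \<subseteq> finite_metrics" "?C \<subseteq> finite_metrics"
      by (auto simp: A_def intro: metrics_upto_finite separated_metrics_finite)
    from pseudometric.chain_colouring_Un[OF pseudometric_finite_metrics this r less_imp_le[OF C.L_pos] colC colA]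
    have "\<exists>c B. chain_colouring (A \<union> ?C) gh ?N r c B" by blast
    moreover have "A \<union> ?C = metrics_upto (Suc n)"
      by (auto simp: A_def separated_metrics_def)
    ultimately show "\<exists>c B. chain_colouring (metrics_upto (Suc n)) gh ?N r c B" by simp
  qed
qed

lemma coarse_dim_le_GH_upto: "coarse_dim_le (GH_upto n) GH_dist (n * (n - 1) div 2)"
proof (rule coarse_dim_le_pullback[where K = 0])
  show "coarse_dim_le (metrics_upto n) gh (n * (n - 1) div 2)"
    by (rule coarse_dim_le_metrics_upto)
  show "GH_rep ` GH_upto n \<subseteq> metrics_upto n" using GH_rep_mem by blast
qed (simp_all add: GH_dist_conv)

lemma pseudometric_GH_upto: "pseudometric (GH_upto n) GH_dist"
proof
  have fin: "GH_rep C \<in> finite_metrics" if "C \<in> GH_upto n" for C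
    using GH_rep_mem[OF that] by (rule metrics_upto_finite)
  fix C D E assume "C \<in> GH_upto n"
  then show "GH_dist C C = 0" by (simp add: GH_dist_conv gh_self fin)
  assume "D \<in> GH_upto n"
  with \<open>C \<in> GH_upto n\<close> show "0 \<le> GH_dist C D" "GH_dist C D = GH_dist D C"
    by (simp_all add: GH_dist_conv gh_nonneg gh_commute fin)
  assume "E \<in> GH_upto n"
  with \<open>C \<in> GH_upto n\<close> \<open>D \<in> GH_upto n\<close> show "GH_dist C E \<le> GH_dist C D + GH_dist D E"
    by (simp add: GH_dist_conv gh_triangle fin)
qed

theorem theorem1:
  fixes n :: nat
  shows "asdim (GH_upto n) GH_dist = enat (n * (n - 1) div 2) \<and>
         coarsely_embeds_into_hilbert_space (GH_upto n) GH_dist"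
proof
  interpret pseudometric "GH_upto n" GH_dist by (rule pseudometric_GH_upto)
  have le: "asdim_le (GH_upto n) GH_dist (n * (n - 1) div 2)"
    by (rule coarse_dim_le_imp_asdim_le[OF coarse_dim_le_GH_upto])
  have "(LEAST m. asdim_le (GH_upto n) GH_dist m) = n * (n - 1) div 2"
    using le asdim_le_GH_upto_lower by (rule Least_equality)
  then show "asdim (GH_upto n) GH_dist = enat (n * (n - 1) div 2)"
    using le by (auto simp: asdim_def)
  show "coarsely_embeds_into_hilbert_space (GH_upto n) GH_dist"
    by (rule coarse_dim_le_imp_hilbert_embedding[OF coarse_dim_le_GH_upto])
qed

end
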